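(* Consider the online class matching problem in the indivisible (integral) setting. For every $\gamma\in[0,1]$, there exists a (randomized) online indivisible algorithm that is simultaneously $\left(1-\frac{e^{\gamma-1}}{\gamma+1}\right)$-USW and $\frac{\gamma}{2}$-CEF.
   Context: Online class matching: an instance is a bipartite graph $G=(N,M,E)$ with known agents $N$, items $M$, $E\subseteq M\times N$ ($a$ likes $o$ iff $(o,a)\in E$); agents are partitioned into $k$ known classes $N_1,\dots,N_k$. Items arrive one at a time in adversarial order; upon arrival of $o$ its set of liking agents is revealed and, in the indivisible setting, $o$ must immediately and irrevocably be assigned to at most one agent liking it (each agent receiving at most one item), producing an integral matching $X=(x_{o,a})\in\{0,1\}^{M\times N}$. $V_i(X)=\sum_{a\in N_i}\sum_o x_{o,a}$, $\mathrm{usw}(X)=\sum_i V_i(X)$; for class $j$, $y_j(X)\in\{0,1\}^M$ with $y_j(X)_o=\sum_{a\in N_j}x_{o,a}$ (the indicator of the set of items assigned to class $j$). For $y\in[0,1]^M$, $V_i^*(y)$ is the maximum size of a fractional matching using edges of $E$ between $N_i$ and $M$ with degree at most $y_o$ at each item $o$ and at most $1$ at each agent. A randomized algorithm outputting $X$ is $\alpha$-CEF if on every instance $\mathbb{E}[V_i(X)]\ge\alpha\,\mathbb{E}[V_i^*(y_j(X))]$ for all classes $i,j$, and $\beta$-USW if on every instance $\mathbb{E}[\mathrm{usw}(X)]\ge\beta\,\mathrm{usw}(X^* )$ for every matching $X^*$ of $G$. *)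

theory Defs
  imports "HOL-Probability.Probability"
begin

text \<open>
  Online class matching, indivisible setting.
  Agents have type 'a, items type 'o. An instance consists of a finite agent set N,
  a class labelling cls (class i is {a \<in> N. cls a = i}), a finite item set M and
  edges E \<subseteq> M \<times> N. Items arrive in an order given by a list os (distinct, set os = M).

  A randomized online algorithm knows N and the classes in advance. On arrival of
  an item it sees the set S of agents liking the item, together with the history
  of previously revealed liking sets and its own previous decisions, and outputs a
  probability distribution over decisions (None = discard, Some a = assign to a).
\<close>

type_synonym 'a online_alg =
  "'a set \<Rightarrow> ('a \<Rightarrow> nat) \<Rightarrow> ('a set \<times> 'a option) list \<Rightarrow> 'a set \<Rightarrow> 'a option pmf"

definition matched_agents :: "('a set \<times> 'a option) list \<Rightarrow> 'a set" where
  "matched_agents h = {a. Some a \<in> snd ` set h}"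

definition valid_alg :: "'a online_alg \<Rightarrow> bool" where
  "valid_alg alg \<longleftrightarrow>
     (\<forall>N cls h S. set_pmf (alg N cls h S) \<subseteq>
        insert None (Some ` {a \<in> S \<inter> N. a \<notin> matched_agents h}))"

fun run :: "'a online_alg \<Rightarrow> 'a set \<Rightarrow> ('a \<Rightarrow> nat) \<Rightarrow> ('o \<times> 'a) set
            \<Rightarrow> ('a set \<times> 'a option) list \<Rightarrow> 'o list \<Rightarrow> ('o \<times> 'a) set pmf" where
  "run alg N cls E h [] = return_pmf {}"
| "run alg N cls E h (x # os) =
     (let S = {a \<in> N. (x, a) \<in> E} in
      bind_pmf (alg N cls h S) (\<lambda>d.
        map_pmf (\<lambda>X. case d of None \<Rightarrow> X | Some a \<Rightarrow> insert (x, a) X)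
                (run alg N cls E (h @ [(S, d)]) os)))"

definition class_of :: "'a set \<Rightarrow> ('a \<Rightarrow> nat) \<Rightarrow> nat \<Rightarrow> 'a set" where
  "class_of N cls i = {a \<in> N. cls a = i}"

definition Vcls :: "'a set \<Rightarrow> ('a \<Rightarrow> nat) \<Rightarrow> nat \<Rightarrow> ('o \<times> 'a) set \<Rightarrow> real" where
  "Vcls N cls i X = real (card {(x, a) \<in> X. a \<in> class_of N cls i})"

definition ycls :: "'a set \<Rightarrow> ('a \<Rightarrow> nat) \<Rightarrow> nat \<Rightarrow> ('o \<times> 'a) set \<Rightarrow> 'o \<Rightarrow> real" where
  "ycls N cls j X x = (if \<exists>a \<in> class_of N cls j. (x, a) \<in> X then 1 else 0)"

definition frac_matching ::
  "'a set \<Rightarrow> 'o set \<Rightarrow> ('o \<times> 'a) set \<Rightarrow> ('o \<Rightarrow> real) \<Rightarrow> ('o \<times> 'a \<Rightarrow> real) \<Rightarrow> bool" where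
  "frac_matching Ni M E y f \<longleftrightarrow>
     (\<forall>e. 0 \<le> f e) \<and>
     (\<forall>e. e \<notin> E \<inter> (M \<times> Ni) \<longrightarrow> f e = 0) \<and>
     (\<forall>x \<in> M. (\<Sum>a \<in> Ni. f (x, a)) \<le> y x) \<and>
     (\<forall>a \<in> Ni. (\<Sum>x \<in> M. f (x, a)) \<le> 1)"

definition Vstar ::
  "'a set \<Rightarrow> ('a \<Rightarrow> nat) \<Rightarrow> 'o set \<Rightarrow> ('o \<times> 'a) set \<Rightarrow> nat \<Rightarrow> ('o \<Rightarrow> real) \<Rightarrow> real" where
  "Vstar N cls M E i y =
     Sup {(\<Sum>e \<in> E \<inter> (M \<times> class_of N cls i). f e) | f.
            frac_matching (class_of N cls i) M E y f}"

definition is_matching :: "('o \<times> 'a) set \<Rightarrow> ('o \<times> 'a) set \<Rightarrow> bool" where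
  "is_matching E X \<longleftrightarrow> X \<subseteq> E \<and>
     (\<forall>x a b. (x, a) \<in> X \<longrightarrow> (x, b) \<in> X \<longrightarrow> a = b) \<and>
     (\<forall>x p a. (x, a) \<in> X \<longrightarrow> (p, a) \<in> X \<longrightarrow> x = p)"

definition usw :: "('o \<times> 'a) set \<Rightarrow> real" where
  "usw X = real (card X)"

definition instance_ok :: "'a set \<Rightarrow> 'o set \<Rightarrow> ('o \<times> 'a) set \<Rightarrow> bool" where
  "instance_ok N M E \<longleftrightarrow> finite N \<and> finite M \<and> E \<subseteq> M \<times> N"

definition arrival_order :: "'o set \<Rightarrow> 'o list \<Rightarrow> bool" where
  "arrival_order M os \<longleftrightarrow> distinct os \<and> set os = M"

definition is_CEF :: "real \<Rightarrow> 'a online_alg \<Rightarrow> 'o itself \<Rightarrow> bool" where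
  "is_CEF \<alpha> alg _ \<longleftrightarrow>
     (\<forall>(N :: 'a set) cls (M :: 'o set) E os. instance_ok N M E \<longrightarrow> arrival_order M os \<longrightarrow>
        (\<forall>i j. measure_pmf.expectation (run alg N cls E [] os) (Vcls N cls i)
               \<ge> \<alpha> * measure_pmf.expectation (run alg N cls E [] os)
                        (\<lambda>X. Vstar N cls M E i (ycls N cls j X))))"

definition is_USW :: "real \<Rightarrow> 'a online_alg \<Rightarrow> 'o itself \<Rightarrow> bool" where
  "is_USW \<beta> alg _ \<longleftrightarrow>
     (\<forall>(N :: 'a set) cls (M :: 'o set) E os. instance_ok N M E \<longrightarrow> arrival_order M os \<longrightarrow>
        (\<forall>Xs. is_matching E Xs \<longrightarrow>
           measure_pmf.expectation (run alg N cls E [] os) usw \<ge> \<beta> * usw Xs))"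

end

theory Submission
  imports Defs
begin

text \<open>
  Every agent draws a rank uniformly from $[0,1]$; ranks below \<open>\<gamma>\<close> are treated as equal. An arriving item
  prefers low agents (rank below \<open>\<gamma>\<close>), choosing among the classes of available low agents
  uniformly at random, and otherwise takes the available agent of least rank.

  Welfare: this is Ranking whose price function is the constant
  \<open>e^(\<gamma>-1)/(\<gamma>+1)\<close> on low ranks and \<open>e^(x-1)\<close> above. For an edge between \<open>a\<close> and \<open>t\<close>, compare
  with the run without \<open>a\<close>: a lower rank than that of the agent serving \<open>t\<close> there guarantees that
  \<open>a\<close> is matched, and adding \<open>a\<close> never makes \<open>t\<close> worse off. Averaging over the rank of \<open>a\<close>, the
  edge collects an expected dual value of at least \<open>1 - e^(\<gamma>-1)/(\<gamma>+1)\<close>.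

  Envy: call \<open>a\<close> stuck if it would stay unmatched even with a low rank. Stuckness does not depend on
  the rank of \<open>a\<close>, and a low agent that is not stuck is matched. The agents of class \<open>i\<close> that are not
  stuck, together with the items given to \<open>j\<close> that some stuck agent of class \<open>i\<close> likes, form a vertex
  cover of the envy graph. Both parts have expected size at most \<open>E[V_i]/\<gamma>\<close>: the first stuck agent
  is low with probability \<open>\<gamma>\<close>, and then classes \<open>i\<close> and \<open>j\<close> compete on equal terms for the item.
\<close>

subsection \<open>Greedy assignment\<close>

text \<open>Low agents of one class share a key, so ties in \<open>k\<close> are no exception; the
  fixed numbering \<open>e\<close> breaks them and turns the preference into a strict total
  order.\<close>

definition better :: "('a \<Rightarrow> nat) \<Rightarrow> ('a \<Rightarrow> real) \<Rightarrow> 'a \<Rightarrow> 'a \<Rightarrow> bool" where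
  "better e k a b \<longleftrightarrow> k a < k b \<or> k a = k b \<and> e a < e b"

definition pick :: "('a \<Rightarrow> nat) \<Rightarrow> ('a \<Rightarrow> real) \<Rightarrow> 'a set \<Rightarrow> 'a option" where
  "pick e k A = (if A = {} then None
     else Some (SOME a. a \<in> A \<and> (\<forall>b\<in>A. b \<noteq> a \<longrightarrow> better e k a b)))"

lemma better_trans: "better e k a b \<Longrightarrow> better e k b c \<Longrightarrow> better e k a c"
  by (auto simp: better_def)

lemma better_asym: "better e k a b \<Longrightarrow> \<not> better e k b a"
  by (auto simp: better_def)

lemma better_total: "inj_on e A \<Longrightarrow> a \<in> A \<Longrightarrow> b \<in> A \<Longrightarrow> a \<noteq> b \<Longrightarrow> better e k a b \<or> better e k b a"
  unfolding better_def by (metis inj_on_def linorder_neqE_nat linorder_neqE_linordered_idom)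

lemma ex_best:
  assumes "finite A" "A \<noteq> {}" "inj_on e A"
  shows "\<exists>a\<in>A. \<forall>b\<in>A. b \<noteq> a \<longrightarrow> better e k a b"
  using assms
proof (induction A rule: finite_ne_induct)
  case (insert x F)
  then obtain a where a: "a \<in> F" "\<forall>b\<in>F. b \<noteq> a \<longrightarrow> better e k a b"
    by (auto simp: inj_on_insert)
  have "better e k a x \<or> better e k x a"
    using better_total[OF insert.prems] a(1) insert.hyps by blast
  then show ?case
    using a better_trans[of e k x a] by (metis insert_iff)
qed auto

lemma pick_None_iff [simp]: "pick e k A = None \<longleftrightarrow> A = {}"
  by (simp add: pick_def)

lemma pick_empty [simp]: "pick e k {} = None"
  by simp

lemma pick_Some_iff:
  assumes "finite A" "inj_on e A"
  shows "pick e k A = Some a \<longleftrightarrow> a \<in> A \<and> (\<forall>b\<in>A. b \<noteq> a \<longrightarrow> better e k a b)"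
proof (cases "A = {}")
  case False
  let ?P = "\<lambda>a. a \<in> A \<and> (\<forall>b\<in>A. b \<noteq> a \<longrightarrow> better e k a b)"
  have ex: "\<exists>a. ?P a"
    using ex_best[OF assms(1) False assms(2), of k] by blast
  have uniq: "a = b" if "?P a" "?P b" for a b
    using that better_asym by metis
  have "(SOME a. ?P a) = a \<longleftrightarrow> ?P a"
    using someI_ex[OF ex] uniq by blast
  then show ?thesis
    using False by (simp add: pick_def)
qed auto

lemma pick_cong:
  assumes "finite A" "inj_on e A" "\<And>a. a \<in> A \<Longrightarrow> k a = k' a"
  shows "pick e k A = pick e k' A"
proof (rule option.expand)
  show "(pick e k A = None) = (pick e k' A = None)" by simp
  have "pick e k' A = Some a" if "pick e k A = Some a" for a
    using that assms(3) by (auto simp: pick_Some_iff[OF assms(1,2)] better_def)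
  then show "the (pick e k A) = the (pick e k' A)" if "pick e k A \<noteq> None"
    using that by force
qed

locale greedy =
  fixes e :: "'a \<Rightarrow> nat" and N :: "'a set"
  assumes fin: "finite N" and inj: "inj_on e N"
begin

text \<open>Keys depend on the time as well as the agent because tickets are redrawn for every item.
  The liking sets \<open>S\<close> are a parameter so that the run without an agent is the same
  process with smaller sets.\<close>

fun taken :: "(nat \<Rightarrow> 'a \<Rightarrow> real) \<Rightarrow> (nat \<Rightarrow> 'a set) \<Rightarrow> nat \<Rightarrow> 'a set" where
  "taken k S 0 = {}"
| "taken k S (Suc t) = taken k S t \<union> set_option (pick e (k t) (S t - taken k S t))"

definition dec :: "(nat \<Rightarrow> 'a \<Rightarrow> real) \<Rightarrow> (nat \<Rightarrow> 'a set) \<Rightarrow> nat \<Rightarrow> 'a option" where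
  "dec k S t = pick e (k t) (S t - taken k S t)"

lemma pick_Some: "A \<subseteq> N \<Longrightarrow>
    pick e k A = Some a \<longleftrightarrow> a \<in> A \<and> (\<forall>b\<in>A. b \<noteq> a \<longrightarrow> better e k a b)"
  by (rule pick_Some_iff) (auto intro: finite_subset[OF _ fin] inj_on_subset[OF inj])

lemma dec_Some_iff:
  "S t \<subseteq> N \<Longrightarrow> dec k S t = Some a \<longleftrightarrow> a \<in> S t \<and> a \<notin> taken k S t \<and>
     (\<forall>b\<in>S t. b \<notin> taken k S t \<longrightarrow> b \<noteq> a \<longrightarrow> better e (k t) a b)"
  unfolding dec_def by (subst pick_Some) auto

lemma dec_None_iff: "dec k S t = None \<longleftrightarrow> S t \<subseteq> taken k S t"
  by (auto simp: dec_def)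

lemma taken_Suc: "taken k S (Suc t) = taken k S t \<union> set_option (dec k S t)"
  by (simp add: dec_def)

lemma mem_taken_iff: "a \<in> taken k S t \<longleftrightarrow> (\<exists>s<t. dec k S s = Some a)"
proof (induction t)
  case (Suc t)
  then show ?case
    unfolding taken_Suc by (auto simp: less_Suc_eq elem_set)
qed simp

lemma taken_mono: "s \<le> t \<Longrightarrow> taken k S s \<subseteq> taken k S t"
  unfolding mem_taken_iff subset_iff by (blast intro: order.strict_trans2)

lemma taken_cong:
  assumes "\<And>s a. s < t \<Longrightarrow> a \<in> S s \<Longrightarrow> k s a = k' s a" "\<forall>s. S s \<subseteq> N"
  shows "taken k S t = taken k' S t"
  using assms(1)
proof (induction t)
  case (Suc t)
  then have "taken k S t = taken k' S t" by simp
  moreover have "pick e (k t) (S t - A) = pick e (k' t) (S t - A)" for A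
    using Suc.prems assms(2)
    by (intro pick_cong finite_subset[OF _ fin] inj_on_subset[OF inj]) auto
  ultimately show ?case by simp
qed simp

lemma dec_cong:
  assumes "\<And>s a. s \<le> t \<Longrightarrow> a \<in> S s \<Longrightarrow> k s a = k' s a" "\<forall>s. S s \<subseteq> N"
  shows "dec k S t = dec k' S t"
proof -
  have "taken k S t = taken k' S t"
    using assms by (intro taken_cong) auto
  moreover have "pick e (k t) (S t - A) = pick e (k' t) (S t - A)" for A
    using assms(1)[of t] assms(2)
    by (intro pick_cong finite_subset[OF _ fin] inj_on_subset[OF inj]) auto
  ultimately show ?thesis by (simp add: dec_def)
qed

lemma dec_inj:
  assumes "\<forall>s. S s \<subseteq> N" "dec k S s = Some a" "dec k S t = Some a"
  shows "s = t"
proof (rule ccontr)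
  assume "s \<noteq> t"
  then have "a \<in> taken k S s \<or> a \<in> taken k S t"
    using assms by (auto simp: mem_taken_iff neq_iff)
  then show False
    using assms by (auto simp: dec_Some_iff)
qed

section \<open>Comparing a run with the run that lacks one agent\<close>

abbreviation del :: "'a \<Rightarrow> (nat \<Rightarrow> 'a set) \<Rightarrow> nat \<Rightarrow> 'a set" where
  "del a S \<equiv> \<lambda>t. S t - {a}"

text \<open>By induction, whoever is available in the reduced run is available in the full run. An
  agent other than \<open>a\<close> that the full run chooses while it is still free in the reduced
  run is therefore the best choice there as well.\<close>

lemma taken_del:
  assumes S: "\<forall>s. S s \<subseteq> N"
  shows "taken k S t \<subseteq> insert a (taken k (del a S) t)"
proof (induction t)
  case (Suc t)
  have S': "del a S s \<subseteq> N" for s using S by blast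
  have "b \<in> insert a (taken k (del a S) (Suc t))" if b: "dec k S t = Some b" for b
  proof (cases "b = a \<or> b \<in> taken k (del a S) t")
    case False
    then have "dec k (del a S) t = Some b"
      using b Suc by (subst dec_Some_iff) (auto simp: dec_Some_iff S S')
    then show ?thesis by (simp add: taken_Suc del: taken.simps)
  qed auto
  moreover have "taken k (del a S) t \<subseteq> taken k (del a S) (Suc t)"
    by (rule taken_mono) simp
  ultimately have "taken k S t \<union> set_option (dec k S t) \<subseteq> insert a (taken k (del a S) (Suc t))"
    using Suc.IH by (cases "dec k S t") (simp_all, blast+)
  then show ?case unfolding taken_Suc[of k S] .
qed simp

lemma dec_del_eqI:
  assumes S: "\<forall>s. S s \<subseteq> N" and eq: "taken k (del a S) t = taken k S t"
    and a: "dec k S t \<noteq> Some a"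
  shows "dec k (del a S) t = dec k S t"
proof (cases "dec k S t")
  case None
  then have "dec k (del a S) t = None"
    using eq by (auto simp: dec_None_iff)
  with None show ?thesis by simp
next
  case (Some b)
  have S': "del a S s \<subseteq> N" for s using S by blast
  have "dec k (del a S) t = Some b"
    using Some eq a by (auto simp: dec_Some_iff S S')
  with Some show ?thesis by simp
qed

lemma untaken_del:
  assumes S: "\<forall>s. S s \<subseteq> N" and "a \<notin> taken k S t"
  shows "taken k (del a S) t = taken k S t"
  using assms(2)
proof (induction t)
  case (Suc t)
  from Suc have eq: "taken k (del a S) t = taken k S t" and a: "dec k S t \<noteq> Some a"
    by (auto simp: taken_Suc elem_set simp del: taken.simps)
  with dec_del_eqI[OF S eq a] show ?case by (simp add: taken_Suc del: taken.simps)
qed simp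

lemma dec_del_eq:
  assumes S: "\<forall>s. S s \<subseteq> N" and "a \<notin> taken k S (Suc t)"
  shows "dec k (del a S) t = dec k S t"
proof -
  have "dec k S t \<noteq> Some a" "a \<notin> taken k S t"
    using assms(2) by (auto simp: taken_Suc elem_set simp del: taken.simps)
  then show ?thesis
    by (intro dec_del_eqI[OF S] untaken_del[OF S])
qed

text \<open>By \<open>taken_del\<close> the agent \<open>b\<close> is free in the full run too, so
  the full run serves the item at least as well: an extra agent never hurts an item.\<close>

lemma dec_del_better:
  assumes S: "\<forall>s. S s \<subseteq> N" and b: "dec k (del a S) t = Some b"
  shows "\<exists>c. dec k S t = Some c \<and> (c = b \<or> better e (k t) c b)"
proof -
  have S': "del a S s \<subseteq> N" for s using S by blast
  have "b \<in> S t" "b \<notin> taken k S t"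
    using b taken_del[OF S, of k t a] by (auto simp: dec_Some_iff S')
  then obtain c where c: "dec k S t = Some c"
    by (cases "dec k S t") (auto simp: dec_None_iff)
  then show ?thesis
    using \<open>b \<in> S t\<close> \<open>b \<notin> taken k S t\<close> by (auto simp: dec_Some_iff S)
qed

text \<open>If \<open>a\<close> stayed free up to and including \<open>t\<close>, both runs would
  have made the same decisions, and the agent chosen at \<open>t\<close> would be preferred to the
  available agent \<open>a\<close>. If the reduced run leaves \<open>t\<close> unserved, the last
  assumption is vacuous and \<open>a\<close> is taken.\<close>

lemma taken_if_better:
  assumes S: "\<forall>s. S s \<subseteq> N" and a: "a \<in> S t"
    and "\<And>b. dec k (del a S) t = Some b \<Longrightarrow> better e (k t) a b"
  shows "a \<in> taken k S (Suc t)"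
proof (rule ccontr)
  assume na: "a \<notin> taken k S (Suc t)"
  then have eq: "dec k (del a S) t = dec k S t"
    by (rule dec_del_eq[OF S])
  have "a \<notin> taken k S t"
    using na taken_mono[of t "Suc t" k S] by auto
  moreover from this obtain b where b: "dec k S t = Some b"
    using a by (cases "dec k S t") (auto simp: dec_None_iff)
  moreover have "b \<noteq> a"
    using na b by (auto simp: taken_Suc simp del: taken.simps)
  ultimately have "better e (k t) b a"
    using a by (auto simp: dec_Some_iff S)
  with assms(3)[of b] b eq better_asym show False by metis
qed

text \<open>The agent \<open>a\<close>, if it were given the keys \<open>l\<close>, would never be chosen.\<close>

definition blocked :: "(nat \<Rightarrow> 'a \<Rightarrow> real) \<Rightarrow> (nat \<Rightarrow> 'a \<Rightarrow> real) \<Rightarrow> (nat \<Rightarrow> 'a set) \<Rightarrow> nat \<Rightarrow> 'a \<Rightarrow> bool" where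
  "blocked l k S n a \<longleftrightarrow> (\<forall>t<n. a \<in> S t \<longrightarrow>
     (\<exists>b. dec k (del a S) t = Some b \<and> (k t b < l t a \<or> k t b = l t a \<and> e b < e a)))"

text \<open>While \<open>a\<close> is free the run equals the run without it, so the blocking agent
  is available. The actual keys of \<open>a\<close> are no smaller than \<open>l\<close>, hence that
  agent is preferred.\<close>

lemma blocked_untaken:
  assumes S: "\<forall>s. S s \<subseteq> N" and Q: "blocked l k S n a"
    and l: "\<And>t. l t a \<le> k t a" and t: "t \<le> n"
  shows "a \<notin> taken k S t"
  using t
proof (induction t)
  case (Suc t)
  then have a: "a \<notin> taken k S t" by simp
  have S': "del a S s \<subseteq> N" for s using S by blast
  have "dec k S t \<noteq> Some a"
  proof
    assume d: "dec k S t = Some a"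
    then have "a \<in> S t" by (auto simp: dec_Some_iff S)
    with Q Suc.prems obtain b where b: "dec k (del a S) t = Some b"
      and lt: "k t b < l t a \<or> k t b = l t a \<and> e b < e a"
      unfolding blocked_def by (metis Suc_le_eq)
    have "b \<in> S t" "b \<noteq> a" "b \<notin> taken k S t"
      using b untaken_del[OF S a] by (auto simp: dec_Some_iff S')
    then have "better e (k t) a b"
      using d by (auto simp: dec_Some_iff S)
    with lt l[of t] show False by (auto simp: better_def)
  qed
  with a show ?case by (auto simp: taken_Suc elem_set simp del: taken.simps)
qed simp

text \<open>The run without \<open>a\<close> is traded for the actual run. Stuckness of different
  agents, each defined through its own reduced run, can thus be compared within a single
  run.\<close>

lemma blocked_iff:
  assumes S: "\<forall>s. S s \<subseteq> N" and l: "\<And>t. l t a \<le> k t a"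
  shows "blocked l k S n a \<longleftrightarrow> a \<notin> taken k S n \<and> (\<forall>t<n. a \<in> S t \<longrightarrow>
     (\<exists>b. dec k S t = Some b \<and> (k t b < l t a \<or> k t b = l t a \<and> e b < e a)))"
proof -
  have "dec k (del a S) t = dec k S t" if "a \<notin> taken k S n" "t < n" for t
    using that taken_mono[of "Suc t" n k S] by (intro dec_del_eq[OF S]) auto
  moreover have "a \<notin> taken k S n" if "blocked l k S n a"
    using blocked_untaken[OF S that l] by simp
  ultimately show ?thesis
    unfolding blocked_def by (cases "a \<in> taken k S n") auto
qed

text \<open>At some liked item the reduced run serves nobody or an agent that does not beat
  \<open>a\<close>; by totality \<open>a\<close> beats that agent, and
  \<open>taken_if_better\<close> applies.\<close>

lemma not_blocked_taken:
  assumes S: "\<forall>s. S s \<subseteq> N" and Q: "\<not> blocked l k S n a"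
    and l: "\<And>t. l t a = k t a"
  shows "a \<in> taken k S n"
proof -
  have S': "del a S s \<subseteq> N" for s using S by blast
  from Q obtain t where t: "t < n" "a \<in> S t"
    and nb: "\<And>b. dec k (del a S) t = Some b \<Longrightarrow> \<not> better e (k t) b a"
    unfolding blocked_def better_def l by blast
  have "better e (k t) a b" if b: "dec k (del a S) t = Some b" for b
  proof -
    have "b \<in> N" "b \<noteq> a" using b S by (auto simp: dec_Some_iff S')
    with better_total[OF inj, of a b "k t"] nb[OF b] t(2) S show ?thesis by auto
  qed
  then have "a \<in> taken k S (Suc t)"
    by (rule taken_if_better[OF S t(2)])
  then show ?thesis
    using taken_mono[of "Suc t" n k S] t(1) by auto
qed

end

subsection \<open>Randomising over deterministic policies\<close>

type_synonym 'a hist = "('a set \<times> 'a option) list"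

fun det_run :: "('a hist \<Rightarrow> 'a set \<Rightarrow> 'a option) \<Rightarrow> 'a set \<Rightarrow> ('o \<times> 'a) set \<Rightarrow> 'a hist \<Rightarrow> 'o list
    \<Rightarrow> ('o \<times> 'a) set" where
  "det_run D N E h [] = {}"
| "det_run D N E h (x # os) =
     (let S = {a \<in> N. (x, a) \<in> E}; d = D h S; X = det_run D N E (h @ [(S, d)]) os
      in case d of None \<Rightarrow> X | Some a \<Rightarrow> insert (x, a) X)"

definition consistent :: "('a hist \<Rightarrow> 'a set \<Rightarrow> 'a option) \<Rightarrow> 'a hist \<Rightarrow> bool" where
  "consistent D h \<longleftrightarrow> (\<forall>k<length h. D (take k h) (fst (h ! k)) = snd (h ! k))"

lemma consistent_Nil [simp]: "consistent D []"
  by (simp add: consistent_def)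

lemma consistent_snoc [simp]:
  "consistent D (h @ [(S, d)]) \<longleftrightarrow> consistent D h \<and> D h S = d"
  by (auto simp: consistent_def nth_append less_Suc_eq)

definition hist_prob :: "'w measure \<Rightarrow> ('w \<Rightarrow> 'a hist \<Rightarrow> 'a set \<Rightarrow> 'a option) \<Rightarrow> 'a hist \<Rightarrow> real" where
  "hist_prob M D h = measure M {w \<in> space M. consistent (D w) h}"

text \<open>An online algorithm sees its earlier decisions but carries no hidden seed, so a seeded
  policy is replaced by the conditional law of its next decision, given that the seed agrees with
  the history. Null histories admit no conditioning; the default there is to discard, which is
  always valid.\<close>

definition behavioural ::
    "'w measure \<Rightarrow> ('w \<Rightarrow> 'a hist \<Rightarrow> 'a set \<Rightarrow> 'a option) \<Rightarrow> 'a hist \<Rightarrow> 'a set \<Rightarrow> 'a option pmf" where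
  "behavioural M D h S =
     (if hist_prob M D h = 0 then return_pmf None
      else embed_pmf (\<lambda>d. hist_prob M D (h @ [(S, d)]) / hist_prob M D h))"

locale policy_mixture = prob_space M for M :: "'w measure" +
  fixes D :: "'w \<Rightarrow> 'a hist \<Rightarrow> 'a set \<Rightarrow> 'a option" and N :: "'a set"
  assumes finN: "finite N"
    and D_valid: "D w h S \<in> insert None (Some ` {a \<in> S \<inter> N. a \<notin> matched_agents h})"
    and D_meas [measurable]: "(\<lambda>w. D w h S) \<in> measurable M (count_space UNIV)"
begin

abbreviation decisions :: "'a option set" where
  "decisions \<equiv> insert None (Some ` N)"

lemma D_decisions: "D w h S \<in> decisions"
  using D_valid[of w h S] by auto

lemma consistent_meas [measurable]: "Measurable.pred M (\<lambda>w. consistent (D w) h)"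
proof -
  have "Measurable.pred M (\<lambda>w. D w (take k h) (fst (h ! k)) = snd (h ! k))" for k
    using measurable_compose[OF D_meas, of "\<lambda>d. d = snd (h ! k)" "count_space UNIV"] by simp
  then show ?thesis
    unfolding consistent_def by (intro pred_intros_countable pred_intros_imp') 
qed

lemma D_eq_meas [measurable]: "Measurable.pred M (\<lambda>w. D w h S = d)"
  using measurable_compose[OF D_meas, of "\<lambda>d'. d' = d" "count_space UNIV"] by simp

lemma sum_hist_prob: "(\<Sum>d\<in>decisions. hist_prob M D (h @ [(S, d)])) = hist_prob M D h"
proof -
  have "(\<Sum>d\<in>decisions. hist_prob M D (h @ [(S, d)])) =
      measure M (\<Union>d\<in>decisions. {w \<in> space M. consistent (D w) (h @ [(S, d)])})"
    unfolding hist_prob_def using finN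
    by (intro finite_measure_finite_Union[symmetric]) (auto simp: disjoint_family_on_def)
  also have "(\<Union>d\<in>decisions. {w \<in> space M. consistent (D w) (h @ [(S, d)])}) =
      {w \<in> space M. consistent (D w) h}"
    using D_decisions[of _ h S] by auto
  finally show ?thesis by (simp add: hist_prob_def)
qed

lemma hist_prob_nonneg [simp]: "hist_prob M D h \<ge> 0"
  by (simp add: hist_prob_def)

lemma hist_prob_outside:
  assumes "d \<notin> insert None (Some ` {a \<in> S \<inter> N. a \<notin> matched_agents h})"
  shows "hist_prob M D (h @ [(S, d)]) = 0"
proof -
  have "D w h S \<noteq> d" for w
    using assms D_valid[of w h S] by metis
  then have "{w \<in> space M. consistent (D w) (h @ [(S, d)])} = {}"
    by auto
  then show ?thesis unfolding hist_prob_def by (simp only: measure_empty)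
qed

lemma hist_prob_outside':
  "d \<notin> decisions \<Longrightarrow> hist_prob M D (h @ [(S, d)]) = 0"
  by (rule hist_prob_outside) auto

lemma pmf_behavioural:
  assumes "hist_prob M D h \<noteq> 0"
  shows "pmf (behavioural M D h S) d = hist_prob M D (h @ [(S, d)]) / hist_prob M D h"
proof -
  let ?f = "\<lambda>d. hist_prob M D (h @ [(S, d)]) / hist_prob M D h"
  have fin: "finite decisions" using finN by simp
  have "(\<integral>\<^sup>+ d. ennreal (?f d) \<partial>count_space UNIV) = (\<Sum>d\<in>decisions. ennreal (?f d))"
    using fin by (intro nn_integral_count_space') (auto simp del: insert_iff simp: hist_prob_outside')
  also have "\<dots> = ennreal (\<Sum>d\<in>decisions. ?f d)"
    by (intro sum_ennreal) simp
  also have "(\<Sum>d\<in>decisions. ?f d) = 1"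
    using assms by (simp only: sum_divide_distrib[symmetric] sum_hist_prob) simp
  finally have "(\<integral>\<^sup>+ d. ennreal (?f d) \<partial>count_space UNIV) = 1" by simp
  then show ?thesis
    using assms unfolding behavioural_def by (simp add: pmf_embed_pmf)
qed

lemma set_pmf_behavioural:
  "set_pmf (behavioural M D h S) \<subseteq> insert None (Some ` {a \<in> S \<inter> N. a \<notin> matched_agents h})"
proof (cases "hist_prob M D h = 0")
  case True
  then show ?thesis by (simp add: behavioural_def)
next
  case False
  show ?thesis
  proof
    fix d assume "d \<in> set_pmf (behavioural M D h S)"
    then have "hist_prob M D (h @ [(S, d)]) \<noteq> 0"
      by (auto simp: set_pmf_iff pmf_behavioural[OF False])
    then show "d \<in> insert None (Some ` {a \<in> S \<inter> N. a \<notin> matched_agents h})"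
      using hist_prob_outside by blast
  qed
qed

lemma set_pmf_behavioural': "set_pmf (behavioural M D h S) \<subseteq> decisions"
  using set_pmf_behavioural[of h S] by auto

lemma det_run_meas [measurable]:
  "(\<lambda>w. det_run (D w) N E h os) \<in> measurable M (count_space UNIV)"
proof (induction os arbitrary: h)
  case (Cons x os)
  let ?S = "{a \<in> N. (x, a) \<in> E}"
  have [measurable]: "(\<lambda>w. det_run (D w) N E (h @ [(?S, d)]) os) \<in> measurable M (count_space UNIV)" for d
    by (rule Cons.IH)
  have "(\<lambda>w. (\<lambda>d w. case d of None \<Rightarrow> det_run (D w) N E (h @ [(?S, d)]) os
           | Some a \<Rightarrow> insert (x, a) (det_run (D w) N E (h @ [(?S, d)]) os)) (D w h ?S) w)
        \<in> measurable M (count_space UNIV)"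
  proof (rule measurable_compose_countable'[where I = decisions])
    show "countable decisions" using finN by (simp add: countable_finite)
    show "(\<lambda>w. D w h ?S) \<in> measurable M (count_space decisions)"
      using D_decisions measurable_sets[OF D_meas[of h ?S]]
      by (subst measurable_count_space_eq2) (use finN in \<open>auto simp del: insert_iff\<close>)
    show "(\<lambda>w. case d of None \<Rightarrow> det_run (D w) N E (h @ [(?S, d)]) os
           | Some a \<Rightarrow> insert (x, a) (det_run (D w) N E (h @ [(?S, d)]) os))
        \<in> measurable M (count_space UNIV)" if "d \<in> decisions" for d
      by (cases d) (auto intro: measurable_compose[OF Cons.IH])
  qed
  then show ?case by (simp add: Let_def)
qed simp

lemma det_run_subset: "det_run (D w) N E h os \<subseteq> set os \<times> N"
proof (induction os arbitrary: h)
  case (Cons x os)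
  let ?S = "{a \<in> N. (x, a) \<in> E}"
  show ?case
    using D_decisions[of w h ?S] Cons.IH[of "h @ [(?S, D w h ?S)]"]
    by (auto simp: Let_def split: option.splits)
qed simp

lemma integrable_finite_range:
  fixes f :: "'b \<Rightarrow> real"
  assumes "X \<in> measurable M (count_space UNIV)" "\<And>w. X w \<in> A" "finite A"
  shows "integrable M (\<lambda>w. f (X w))"
proof (rule integrable_const_bound[where B = "\<Sum>x\<in>A. \<bar>f x\<bar>"])
  show "AE w in M. norm (f (X w)) \<le> (\<Sum>x\<in>A. \<bar>f x\<bar>)"
    using assms by (auto intro!: member_le_sum)
  show "(\<lambda>w. f (X w)) \<in> borel_measurable M"
    using measurable_compose[OF assms(1), of f borel] by simp
qed

lemma integrable_det_run: "integrable M (\<lambda>w. f (det_run (D w) N E h os) :: real)"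
  by (rule integrable_finite_range[OF det_run_meas, where A = "Pow (set os \<times> N)"])
     (use finN det_run_subset in \<open>blast, simp\<close>)

lemma integrable_consistent:
  "integrable M (\<lambda>w. of_bool (consistent (D w) h) * f (det_run (D w) N E h' os) :: real)"
proof -
  have "integrable M (\<lambda>w. indicator {w\<in>space M. consistent (D w) h} w *\<^sub>R f (det_run (D w) N E h' os))"
    by (intro integrable_mult_indicator integrable_det_run) measurable
  then show ?thesis
    by (rule Bochner_Integration.integrable_cong[THEN iffD1, rotated 2]) (auto simp: indicator_def)
qed

lemma finite_run:
  assumes "\<And>h S. set_pmf (alg N cls h S) \<subseteq> decisions"
  shows "finite (set_pmf (run alg N cls E h os))"
proof (induction os arbitrary: h)
  case (Cons x os)
  have "finite (set_pmf (alg N cls h S))" for h S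
    using finite_subset[OF assms] finN by blast
  with Cons show ?case by (auto simp: Let_def)
qed simp

text \<open>Kuhn's theorem: drawing the seed once or resampling every decision from its conditional law
  given the history produces the same matching in distribution.\<close>

lemma expectation_run:
  fixes f :: "('o \<times> 'a) set \<Rightarrow> real"
  assumes alg: "alg N cls = behavioural M D"
  shows "hist_prob M D h * measure_pmf.expectation (run alg N cls E h os) f =
    (\<integral>w. of_bool (consistent (D w) h) * f (det_run (D w) N E h os) \<partial>M)"
proof (induction os arbitrary: h f)
  case Nil
  have "(\<integral>w. of_bool (consistent (D w) h) * f {} \<partial>M) =
      (\<integral>w. indicator {w\<in>space M. consistent (D w) h} w * f {} \<partial>M)"
    by (rule Bochner_Integration.integral_cong) (auto simp: indicator_def)
  also have "\<dots> = hist_prob M D h * f {}"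
    by (simp add: hist_prob_def)
  finally have eq: "(\<integral>w. of_bool (consistent (D w) h) * f {} \<partial>M) = hist_prob M D h * f {}" .
  show ?case unfolding run.simps det_run.simps eq by simp
next
  case (Cons x os)
  define S where "S = {a \<in> N. (x, a) \<in> E}"
  define ins :: "'a option \<Rightarrow> ('o \<times> 'a) set \<Rightarrow> ('o \<times> 'a) set" where "ins = (\<lambda>d X. case d of None \<Rightarrow> X | Some a \<Rightarrow> insert (x, a) X)"
  have fin: "finite decisions" using finN by simp
  have fr: "finite (set_pmf (run alg N cls E h os))" for h
    by (rule finite_run) (metis alg set_pmf_behavioural')
  have ex: "measure_pmf.expectation (run alg N cls E h (x # os)) f =
     (\<Sum>d\<in>decisions. pmf (behavioural M D h S) d *
        measure_pmf.expectation (run alg N cls E (h @ [(S, d)]) os) (\<lambda>X. f (ins d X)))"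
    unfolding run.simps Let_def S_def[symmetric]
    by (subst pmf_expectation_bind[OF fin])
       (use fr set_pmf_behavioural' alg in \<open>auto simp: ins_def\<close>)
  \<comment> \<open>The factor turns conditional probabilities into joint ones. On a null history
    both sides vanish, so the default decision does no harm.\<close>
  have "hist_prob M D h * pmf (behavioural M D h S) d = hist_prob M D (h @ [(S, d)])" for d
  proof (cases "hist_prob M D h = 0")
    case True
    have "hist_prob M D (h @ [(S, d)]) \<le> hist_prob M D h"
      unfolding hist_prob_def by (intro finite_measure_mono) auto
    with True have "hist_prob M D (h @ [(S, d)]) = 0"
      by (intro antisym) simp_all
    with True show ?thesis by simp
  qed (simp add: pmf_behavioural)
  then have "hist_prob M D h * measure_pmf.expectation (run alg N cls E h (x # os)) f =
     (\<Sum>d\<in>decisions. hist_prob M D (h @ [(S, d)]) *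
        measure_pmf.expectation (run alg N cls E (h @ [(S, d)]) os) (\<lambda>X. f (ins d X)))"
    unfolding ex sum_distrib_left by (simp add: mult.assoc[symmetric] del: sum.insert)
  also have "\<dots> = (\<Sum>d\<in>decisions. \<integral>w. of_bool (consistent (D w) (h @ [(S, d)])) *
      f (ins d (det_run (D w) N E (h @ [(S, d)]) os)) \<partial>M)"
    by (intro sum.cong refl Cons.IH)
  also have "\<dots> = (\<integral>w. (\<Sum>d\<in>decisions. of_bool (consistent (D w) (h @ [(S, d)])) *
      f (ins d (det_run (D w) N E (h @ [(S, d)]) os))) \<partial>M)"
    by (intro Bochner_Integration.integral_sum[symmetric] integrable_consistent)
  also have "\<dots> = (\<integral>w. of_bool (consistent (D w) h) * f (det_run (D w) N E h (x # os)) \<partial>M)"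
  proof (rule Bochner_Integration.integral_cong[OF refl])
    \<comment> \<open>Only the decision \<open>D w h S\<close> extends the history consistently with
      the seed \<open>w\<close>, so the sum collapses to the actual run.\<close>
    fix w
    have "(\<Sum>d\<in>decisions. of_bool (consistent (D w) (h @ [(S, d)])) *
        f (ins d (det_run (D w) N E (h @ [(S, d)]) os))) =
      (\<Sum>d\<in>decisions. if d = D w h S then of_bool (consistent (D w) h) *
        f (ins d (det_run (D w) N E (h @ [(S, d)]) os)) else 0)"
      by (intro sum.cong) auto
    also have "\<dots> = of_bool (consistent (D w) h) * f (det_run (D w) N E h (x # os))"
      using D_decisions[of w h S]
      by (subst sum.delta[OF fin]) (simp del: insert_iff add: Let_def S_def ins_def)
    finally show "(\<Sum>d\<in>decisions. of_bool (consistent (D w) (h @ [(S, d)])) *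
        f (ins d (det_run (D w) N E (h @ [(S, d)]) os))) =
      of_bool (consistent (D w) h) * f (det_run (D w) N E h (x # os))" .
  qed
  finally show ?case .
qed

corollary expectation_run_Nil:
  fixes f :: "('o \<times> 'a) set \<Rightarrow> real"
  assumes "alg N cls = behavioural M D"
  shows "measure_pmf.expectation (run alg N cls E [] os) f = (\<integral>w. f (det_run (D w) N E [] os) \<partial>M)"
  using expectation_run[where alg = alg and cls = cls, OF assms, of "[]" E os f] by (simp add: hist_prob_def prob_space)

end

subsection \<open>Independent uniform seeds\<close>

definition unit_uniform :: "real measure" where
  "unit_uniform = uniform_measure lborel {0..1}"

lemma sets_unit_uniform [measurable_cong, simp]: "sets unit_uniform = sets borel"
  by (simp add: unit_uniform_def)

lemma space_unit_uniform [simp]: "space unit_uniform = UNIV"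
  by (simp add: unit_uniform_def)

interpretation unit_uniform: prob_space unit_uniform
  unfolding unit_uniform_def by (rule prob_space_uniform_measure) auto

lemma prob_unit_uniform:
  assumes "A \<in> sets borel"
  shows "measure unit_uniform A = measure lborel ({0..1} \<inter> A)"
proof -
  have "emeasure lborel ({0..1} \<inter> A) \<le> emeasure lborel {0..1::real}"
    using assms by (intro emeasure_mono) auto
  then show ?thesis
    using assms unfolding unit_uniform_def
    by (simp add: measure_uniform_measure)
qed

lemma prob_unit_uniform_less:
  assumes "0 \<le> g" "g \<le> 1"
  shows "measure unit_uniform {x. x < g} = g"
proof -
  have "{0..1} \<inter> {x. x < g} = {0..<g}" using assms by auto
  then show ?thesis using assms by (subst prob_unit_uniform) auto
qed

lemma prob_unit_uniform_single [simp]: "measure unit_uniform {x} = 0"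
  by (subst prob_unit_uniform) (auto intro!: measure_eq_0_null_sets countable_imp_null_set_lborel)

lemma integral_unit_uniform:
  fixes f :: "real \<Rightarrow> real"
  assumes "f \<in> borel_measurable borel"
  shows "(\<integral>x. f x \<partial>unit_uniform) = (\<integral>x. indicator {0..1} x * f x \<partial>lborel)"
proof -
  have "unit_uniform = density lborel (\<lambda>x. ennreal (indicator {0..1} x))"
    unfolding unit_uniform_def uniform_measure_def
    by (rule density_cong) (auto simp: ennreal_indicator divide_ennreal_def)
  moreover have "(\<integral>x. f x \<partial>density lborel (\<lambda>x. ennreal (indicator {0..1} x))) =
      (\<integral>x. indicator {0..1} x *\<^sub>R f x \<partial>lborel)"
    using assms by (intro integral_density) auto
  ultimately show ?thesis by simp
qed

definition seeds :: "('i \<Rightarrow> real) measure" where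
  "seeds = PiM UNIV (\<lambda>_. unit_uniform)"

interpretation seeds: prob_space "seeds :: ('i \<Rightarrow> real) measure"
  unfolding seeds_def by (rule prob_space_PiM) (rule unit_uniform.prob_space_axioms)

lemma space_seeds [simp]: "space seeds = UNIV"
  by (simp add: seeds_def space_PiM PiE_UNIV_domain)

lemma seeds_component [measurable]: "(\<lambda>w. w i) \<in> borel_measurable seeds"
  unfolding seeds_def by simp

lemma seeds_upd [measurable]: "(\<lambda>(x, w). w(i := x)) \<in> measurable (unit_uniform \<Otimes>\<^sub>M seeds) seeds"
proof -
  have "(\<lambda>p. (snd p)(i := fst p)) \<in> measurable (unit_uniform \<Otimes>\<^sub>M seeds) seeds"
    unfolding seeds_def by (rule measurable_fun_upd[where J = UNIV]) auto
  then show ?thesis by (simp add: case_prod_beta')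
qed

lemma seeds_upd1 [measurable]: "(\<lambda>x. w(i := x)) \<in> measurable unit_uniform seeds"
  using measurable_compose[OF measurable_Pair2' seeds_upd, of w i] by simp

lemma distr_seeds_upd: "distr (unit_uniform \<Otimes>\<^sub>M seeds) seeds (\<lambda>(x, w). w(i := x)) = seeds"
  using distr_pair_PiM_eq_PiM[of UNIV "\<lambda>_. unit_uniform" i] unit_uniform.prob_space_axioms
  unfolding seeds_def by simp

text \<open>By \<open>distr_seeds_upd\<close>, overwriting one coordinate with a fresh draw
  preserves the law; Fubini then averages over that coordinate first. Every argument that varies one
  rank while all other seeds are fixed rests on this.\<close>

lemma integral_resample:
  fixes f :: "('i \<Rightarrow> real) \<Rightarrow> real"
  assumes [measurable]: "f \<in> borel_measurable seeds" and "\<And>w. \<bar>f w\<bar> \<le> B"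
  shows "integrable seeds (\<lambda>w. \<integral>x. f (w(i := x)) \<partial>unit_uniform)"
    and "(\<integral>w. f w \<partial>seeds) = (\<integral>w. (\<integral>x. f (w(i := x)) \<partial>unit_uniform) \<partial>seeds)"
proof -
  interpret P: pair_prob_space unit_uniform "seeds :: ('i \<Rightarrow> real) measure" ..
  have int: "integrable (unit_uniform \<Otimes>\<^sub>M seeds) (\<lambda>(x, w). f (w(i := x)))"
    by (rule P.P.integrable_const_bound[where B = B]) (auto simp: assms(2) case_prod_beta')
  show "integrable seeds (\<lambda>w. \<integral>x. f (w(i := x)) \<partial>unit_uniform)"
    by (rule P.integrable_snd[OF int])
  have "(\<integral>w. f w \<partial>seeds) = (\<integral>w. f w \<partial>distr (unit_uniform \<Otimes>\<^sub>M seeds) seeds (\<lambda>(x, w). w(i := x)))"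
    by (simp only: distr_seeds_upd)
  also have "\<dots> = (\<integral>p. f ((\<lambda>(x, w). w(i := x)) p) \<partial>(unit_uniform \<Otimes>\<^sub>M seeds))"
    by (rule integral_distr) measurable
  also have "\<dots> = (\<integral>w. (\<integral>x. f (w(i := x)) \<partial>unit_uniform) \<partial>seeds)"
    using P.integral_snd[OF int] by (simp add: case_prod_beta')
  finally show "(\<integral>w. f w \<partial>seeds) = (\<integral>w. (\<integral>x. f (w(i := x)) \<partial>unit_uniform) \<partial>seeds)" .
qed

lemma integral_resample_ge:
  fixes f :: "('i \<Rightarrow> real) \<Rightarrow> real"
  assumes "f \<in> borel_measurable seeds" "\<And>w. \<bar>f w\<bar> \<le> B"
    and "\<And>w. c \<le> (\<integral>x. f (w(i := x)) \<partial>unit_uniform)"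
  shows "c \<le> (\<integral>w. f w \<partial>seeds)"
proof -
  have "(\<integral>w. c \<partial>(seeds :: ('i \<Rightarrow> real) measure)) \<le> (\<integral>w. (\<integral>x. f (w(i := x)) \<partial>unit_uniform) \<partial>seeds)"
    using assms integral_resample(1)[OF assms(1,2)] by (intro integral_mono) auto
  then show ?thesis
    using integral_resample(2)[OF assms(1,2), of i] by (simp add: seeds.prob_space[simplified])
qed

lemma integral_of_bool_seeds:
  fixes P :: "('i \<Rightarrow> real) \<Rightarrow> bool"
  assumes [measurable]: "Measurable.pred seeds P"
  shows "(\<integral>w. of_bool (P w) \<partial>seeds) = measure seeds {w. P w}"
proof -
  have "(\<integral>w. of_bool (P w) \<partial>seeds) = (\<integral>w. indicator {w. P w} w \<partial>seeds :: real)"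
    by (rule Bochner_Integration.integral_cong) (auto simp: indicator_def)
  then show ?thesis by simp
qed

lemma prob_resample:
  fixes P :: "('i \<Rightarrow> real) \<Rightarrow> bool"
  assumes P [measurable]: "Measurable.pred seeds P"
  shows "measure seeds {w. P w} = (\<integral>w. measure unit_uniform {x. P (w(i := x))} \<partial>seeds)"
proof -
  have "measure seeds {w. P w} = (\<integral>w. (\<integral>x. of_bool (P (w(i := x))) \<partial>unit_uniform) \<partial>seeds)"
    unfolding integral_of_bool_seeds[OF P, symmetric]
    by (rule integral_resample(2)[where B = 1]) auto
  also have "\<dots> = (\<integral>w. measure unit_uniform {x. P (w(i := x))} \<partial>seeds)"
  proof (rule Bochner_Integration.integral_cong[OF refl])
    fix w :: "'i \<Rightarrow> real"
    have "(\<integral>x. of_bool (P (w(i := x))) \<partial>unit_uniform) =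
      (\<integral>x. indicator {x. P (w(i := x))} x \<partial>unit_uniform :: real)"
      by (rule Bochner_Integration.integral_cong) (auto simp: indicator_def)
    then show "(\<integral>x. of_bool (P (w(i := x))) \<partial>unit_uniform) = measure unit_uniform {x. P (w(i := x))}"
      by simp
  qed
  finally show ?thesis .
qed

text \<open>With the other seeds fixed, \<open>P\<close> is constant in coordinate \<open>i\<close>,
  so the threshold event contributes a factor \<open>g\<close>.\<close>

lemma prob_less_independent:
  fixes P :: "('i \<Rightarrow> real) \<Rightarrow> bool"
  assumes P [measurable]: "Measurable.pred seeds P"
    and inv: "\<And>w x. P (w(i := x)) = P w" and g: "0 \<le> g" "g \<le> 1"
  shows "measure seeds {w. P w \<and> w i < g} = g * measure seeds {w. P w}"
proof -
  have "measure seeds {w. P w \<and> w i < g} =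
      (\<integral>w. measure unit_uniform {x. P (w(i := x)) \<and> (w(i := x)) i < g} \<partial>seeds)"
    by (rule prob_resample) measurable
  also have "\<dots> = (\<integral>w. g * of_bool (P w) \<partial>seeds)"
    by (rule Bochner_Integration.integral_cong) (auto simp: inv prob_unit_uniform_less g)
  also have "\<dots> = g * measure seeds {w. P w}"
    using integral_of_bool_seeds[OF P] by simp
  finally show ?thesis .
qed

lemma AE_seeds_distinct:
  assumes "i \<noteq> j"
  shows "AE w in seeds. w i \<noteq> w j"
proof -
  have pr: "Measurable.pred seeds (\<lambda>w :: 'a \<Rightarrow> real. w i = w j)"
    unfolding pred_def by (rule borel_measurable_eq) measurable
  from pr have "measure seeds {w. w i = w j} = (\<integral>w. measure unit_uniform {x. (w(i := x)) i = (w(i := x)) j} \<partial>seeds)"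
    by (rule prob_resample)
  also have "\<dots> = 0" using assms by simp
  finally have "measure seeds {w :: 'a \<Rightarrow> real. w i = w j} = 0" .
  then have "AE w in seeds. w \<notin> {w :: 'a \<Rightarrow> real. w i = w j}"
    using pr by (subst (asm) seeds.prob_eq_0) (simp_all add: pred_def)
  then show ?thesis by simp
qed

lemma reindex_measurable: "(\<lambda>w. w \<circ> f) \<in> measurable seeds (seeds :: ('i \<Rightarrow> real) measure)"
  unfolding seeds_def by (rule measurable_PiM_single') (auto simp: comp_def)

text \<open>Injective reindexing of independent, identically distributed coordinates preserves their
  law. It is applied to the exchange of two tickets.\<close>

lemma prob_reindex:
  fixes P :: "('i \<Rightarrow> real) \<Rightarrow> bool"
  assumes [measurable]: "Measurable.pred seeds P" and "inj f"
  shows "measure seeds {w. P (w \<circ> f)} = measure seeds {w. P w}"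
proof -
  have d: "distr seeds seeds (\<lambda>w. w \<circ> f) = (seeds :: ('i \<Rightarrow> real) measure)"
    using distr_PiM_reindex[of UNIV "\<lambda>_. unit_uniform" f UNIV] assms(2) unit_uniform.prob_space_axioms
    by (simp add: seeds_def comp_def restrict_def)
  note m = reindex_measurable[of f]
  have "measure seeds {w. P w} = measure (distr seeds seeds (\<lambda>w. w \<circ> f)) {w. P w}"
    by (simp only: d)
  also have "\<dots> = measure seeds {w. P (w \<circ> f)}"
  proof (subst measure_distr[OF m])
    show "{w. P w} \<in> sets seeds" using assms(1) by (simp add: pred_def)
  qed (simp add: vimage_def)
  finally show ?thesis by simp
qed

subsection \<open>The threshold algorithm\<close>

lemma measurable_finite_range:
  assumes "finite I" "\<And>w. f w \<in> I" "\<And>d. Measurable.pred M (\<lambda>w. f w = d)"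
  shows "f \<in> measurable M (count_space UNIV)"
proof -
  have "f \<in> measurable M (count_space I)"
  proof (subst measurable_count_space_eq2[OF assms(1)], intro conjI ballI)
    show "f -` {d} \<inter> space M \<in> sets M" for d
      using assms(3)[of d] by (simp add: pred_def vimage_def Int_def conj_commute)
  qed (use assms(2) in auto)
  then show ?thesis
    by (rule measurable_compose) simp
qed

text \<open>
  A seed has a coordinate \<open>Inl a\<close> for the rank of each agent \<open>a\<close> and a coordinate \<open>Inr (t, c)\<close> for the
  lottery ticket of class \<open>c\<close> at item \<open>t\<close>. Low agents get negative keys, so they precede all others;
  as tickets almost surely differ, the least key picks a uniformly random class among them.
\<close>

definition low_key :: "('a \<Rightarrow> nat) \<Rightarrow> ('a + nat \<times> nat \<Rightarrow> real) \<Rightarrow> nat \<Rightarrow> 'a \<Rightarrow> real" where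
  "low_key cls w t a = - exp (w (Inr (t, cls a)))"

definition key :: "real \<Rightarrow> ('a \<Rightarrow> nat) \<Rightarrow> ('a + nat \<times> nat \<Rightarrow> real) \<Rightarrow> nat \<Rightarrow> 'a \<Rightarrow> real" where
  "key g cls w t a = (if w (Inl a) < g then low_key cls w t a else w (Inl a))"

text \<open>The length of the history identifies the arriving item, so every item consults its own
  tickets.\<close>

definition policy :: "real \<Rightarrow> 'a set \<Rightarrow> ('a \<Rightarrow> nat) \<Rightarrow> ('a + nat \<times> nat \<Rightarrow> real) \<Rightarrow> 'a hist \<Rightarrow> 'a set
    \<Rightarrow> 'a option" where
  "policy g N cls w h S =
     pick (to_nat_on N) (key g cls w (length h)) (S \<inter> N - matched_agents h)"

text \<open>\<open>valid_alg\<close> also ranges over infinite agent sets, where always discarding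
  is a valid choice.\<close>

definition threshold_alg :: "real \<Rightarrow> 'a online_alg" where
  "threshold_alg g N cls h S =
     (if finite N then behavioural seeds (policy g N cls) h S else return_pmf None)"

lemma low_key_measurable [measurable]: "(\<lambda>w. low_key cls w t a) \<in> borel_measurable seeds"
  unfolding low_key_def by measurable

lemma key_measurable [measurable]: "(\<lambda>w. key g cls w t a) \<in> borel_measurable seeds"
  unfolding key_def by measurable

lemma better_measurable [measurable]:
  assumes [measurable]: "\<And>a. (\<lambda>w. k w a) \<in> borel_measurable M"
  shows "Measurable.pred M (\<lambda>w. better e (k w) a b)"
  unfolding better_def by measurable

lemma pick_measurable:
  assumes k: "\<And>a. (\<lambda>w. k w a) \<in> borel_measurable M" and A: "finite A" "inj_on e A"
  shows "(\<lambda>w. pick e (k w) A) \<in> measurable M (count_space UNIV)"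
proof (rule measurable_finite_range[where I = "insert None (Some ` A)"])
  show "pick e (k w) A \<in> insert None (Some ` A)" for w
    by (cases "pick e (k w) A") (auto simp: pick_Some_iff[OF A])
  show "Measurable.pred M (\<lambda>w. pick e (k w) A = d)" for d
  proof (cases d)
    case (Some a)
    have [measurable]: "Measurable.pred M (\<lambda>w. better e (k w) a b)" for b
      using k by (rule better_measurable)
    show ?thesis
      unfolding Some pick_Some_iff[OF A] using A(1) by measurable
  qed simp
qed (use A in simp)

locale class_matching =
  fixes g :: real and N :: "'a set" and cls :: "'a \<Rightarrow> nat"
  assumes g0: "0 \<le> g" and g1: "g \<le> 1" and finN: "finite N"
begin

abbreviation "e \<equiv> to_nat_on N"

lemma inj_e: "inj_on e N"
  using finN by (intro inj_on_to_nat_on countable_finite)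

sublocale greedy e N
  using finN inj_e by unfold_locales

lemma policy_valid: "policy g N cls w h S \<in> insert None (Some ` {a \<in> S \<inter> N. a \<notin> matched_agents h})"
proof (cases "policy g N cls w h S")
  case (Some a)
  then have "a \<in> S \<inter> N - matched_agents h"
    unfolding policy_def by (subst (asm) pick_Some) auto
  with Some show ?thesis by auto
qed simp

sublocale mixture: policy_mixture "seeds :: ('a + nat \<times> nat \<Rightarrow> real) measure" "policy g N cls" N
proof
  show "(\<lambda>w. policy g N cls w h S) \<in> measurable seeds (count_space UNIV)" for h S
    unfolding policy_def
    by (rule pick_measurable) (auto intro: finite_subset[OF _ finN] inj_on_subset[OF inj_e])
qed (rule finN policy_valid)+

lemma low_key_neg: "low_key cls w t a < 0"
  by (simp add: low_key_def)

lemma low_key_le: "low_key cls w t a \<le> key g cls w t a"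
  using low_key_neg[of w t a] g0 by (simp add: key_def)

lemma key_neg_iff: "key g cls w t a < 0 \<longleftrightarrow> w (Inl a) < g"
  using low_key_neg[of w t a] g0 by (simp add: key_def)

lemma key_upd [simp]: "b \<noteq> a \<Longrightarrow> key g cls (w(Inl a := x)) t b = key g cls w t b"
  by (simp add: key_def low_key_def)

lemma low_key_upd: "low_key cls (w(Inl a := x)) = low_key cls w"
  by (simp add: low_key_def fun_eq_iff)

end

section \<open>The run of the algorithm on a fixed instance\<close>

locale class_matching_instance = class_matching g N cls
  for g :: real and N :: "'a set" and cls :: "'a \<Rightarrow> nat" +
  fixes M :: "'o set" and E :: "('o \<times> 'a) set" and os :: "'o list"
  assumes inst: "instance_ok N M E" and ord: "arrival_order M os"
begin

text \<open>\<open>greedy\<close> works with sequences over all naturals; after the last item nobody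
  likes anything, so nothing more happens.\<close>

definition S :: "nat \<Rightarrow> 'a set" where
  "S t = (if t < length os then {a \<in> N. (os ! t, a) \<in> E} else {})"

abbreviation "n \<equiv> length os"
abbreviation "K \<equiv> key g cls"
abbreviation "L \<equiv> low_key cls"
abbreviation "X w \<equiv> det_run (policy g N cls w) N E [] os"

lemma S_N: "\<forall>t. S t \<subseteq> N"
  by (auto simp: S_def)

lemma del_S_N: "\<forall>t. S t - {a} \<subseteq> N"
  using S_N by blast

lemma dist_os: "distinct os" and set_os: "set os = M"
  using ord by (auto simp: arrival_order_def)

lemma finM: "finite M" and E_sub: "E \<subseteq> M \<times> N"
  using inst by (auto simp: instance_ok_def)

definition hist :: "('a + nat \<times> nat \<Rightarrow> real) \<Rightarrow> nat \<Rightarrow> 'a hist" where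
  "hist w t = map (\<lambda>s. (S s, dec (K w) S s)) [0..<t]"

lemma matched_agents_hist: "matched_agents (hist w t) = taken (K w) S t"
  by (force simp: matched_agents_def hist_def mem_taken_iff image_image image_iff)

lemma policy_hist: "policy g N cls w (hist w t) (S t) = dec (K w) S t"
proof -
  have "S t \<inter> N = S t" using S_N by blast
  then show ?thesis
    by (simp add: policy_def matched_agents_hist dec_def) (simp add: hist_def)
qed

text \<open>Translates the list recursion into the indexed greedy process. The induction runs
  downwards because \<open>det_run\<close> recurses on the remaining items.\<close>

lemma det_run_hist:
  "t \<le> n \<Longrightarrow> det_run (policy g N cls w) N E (hist w t) (drop t os) =
     {(os ! s, a) | s a. t \<le> s \<and> s < n \<and> dec (K w) S s = Some a}"
proof (induction t rule: inc_induct)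
  case base
  then show ?case by auto
next
  case (step t)
  have d: "drop t os = os ! t # drop (Suc t) os"
    using step.hyps by (simp add: Cons_nth_drop_Suc)
  have St: "{a \<in> N. (os ! t, a) \<in> E} = S t"
    using step.hyps by (simp add: S_def)
  have h: "hist w t @ [(S t, dec (K w) S t)] = hist w (Suc t)"
    by (simp add: hist_def)
  have lt: "t \<le> s \<longleftrightarrow> s = t \<or> Suc t \<le> s" for s by auto
  show ?case
    unfolding d det_run.simps Let_def St policy_hist h step.IH
    using step.hyps by (cases "dec (K w) S t") (auto simp: lt)
qed

lemma X_eq: "X w = {(os ! s, a) | s a. s < n \<and> dec (K w) S s = Some a}"
  using det_run_hist[of 0 w] by (simp add: hist_def)

lemma dec_N: "dec (K w) S t = Some a \<Longrightarrow> a \<in> N"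
  using S_N by (auto simp: dec_Some_iff)

text \<open>Every taken agent is chosen at exactly one item, so a sum over matched agents can be
  regrouped by items. Both the welfare split and the two counts of a class value use this.\<close>

lemma sum_taken:
  fixes f :: "'a \<Rightarrow> real"
  shows "(\<Sum>a\<in>N. of_bool (a \<in> taken (K w) S n) * f a) =
    (\<Sum>t<n. case dec (K w) S t of None \<Rightarrow> 0 | Some b \<Rightarrow> f b)"
proof -
  have tk: "of_bool (a \<in> taken (K w) S n) = (\<Sum>t<n. of_bool (dec (K w) S t = Some a) :: real)" for a
  proof (cases "a \<in> taken (K w) S n")
    case True
    then obtain s where s: "s < n" "dec (K w) S s = Some a"
      unfolding mem_taken_iff by blast
    have "dec (K w) S t = Some a \<longleftrightarrow> t = s" for t
      using s dec_inj[OF S_N s(2), of t] by blast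
    then have "(\<Sum>t<n. of_bool (dec (K w) S t = Some a) :: real) = (\<Sum>t<n. if t = s then 1 else 0)"
      by (simp add: of_bool_def)
    then show ?thesis using s True by simp
  qed (auto simp: mem_taken_iff)
  have "(\<Sum>a\<in>N. of_bool (a \<in> taken (K w) S n) * f a) =
      (\<Sum>t<n. \<Sum>a\<in>N. of_bool (dec (K w) S t = Some a) * f a)"
    unfolding tk sum_distrib_right by (rule sum.swap)
  also have "\<dots> = (\<Sum>t<n. case dec (K w) S t of None \<Rightarrow> 0 | Some b \<Rightarrow> f b)"
  proof (rule sum.cong[OF refl])
    fix t
    show "(\<Sum>a\<in>N. of_bool (dec (K w) S t = Some a) * f a) =
        (case dec (K w) S t of None \<Rightarrow> 0 | Some b \<Rightarrow> f b)"
    proof (cases "dec (K w) S t")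
      case (Some b)
      have "(\<Sum>a\<in>N. of_bool (b = a) * f a) = (\<Sum>a\<in>N. if b = a then f a else 0)"
        by (rule sum.cong) auto
      then show ?thesis using Some dec_N[OF Some] finN by simp
    qed simp
  qed
  finally show ?thesis .
qed

lemma card_X:
  "real (card {(x, a) \<in> X w. a \<in> A}) =
     (\<Sum>t<n. case dec (K w) S t of None \<Rightarrow> 0 | Some b \<Rightarrow> of_bool (b \<in> A))"
proof -
  define Y where "Y t = (case dec (K w) S t of None \<Rightarrow> {} | Some b \<Rightarrow> if b \<in> A then {(os ! t, b)} else {})" for t
  have "{(x, a) \<in> X w. a \<in> A} = (\<Union>t<n. Y t)"
    unfolding X_eq Y_def by (force split: option.splits if_splits)
  moreover have "Y s \<inter> Y t = {}" if "s < n" "t < n" "s \<noteq> t" for s t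
    using that dist_os by (auto simp: Y_def nth_eq_iff_index_eq split: option.splits if_splits)
  then have "card (\<Union>t<n. Y t) = (\<Sum>t<n. card (Y t))"
    by (intro card_UN_disjoint) (auto simp: Y_def split: option.splits)
  moreover have "real (card (Y t)) = (case dec (K w) S t of None \<Rightarrow> 0 | Some b \<Rightarrow> of_bool (b \<in> A))" for t
    by (auto simp: Y_def split: option.splits)
  ultimately show ?thesis by simp
qed

lemma card_X_taken:
  "real (card {(x, a) \<in> X w. a \<in> A}) = (\<Sum>a\<in>A \<inter> N. of_bool (a \<in> taken (K w) S n))"
proof -
  have "real (card {(x, a) \<in> X w. a \<in> A}) = (\<Sum>a\<in>N. of_bool (a \<in> taken (K w) S n) * of_bool (a \<in> A))"
    unfolding card_X sum_taken ..
  also have "\<dots> = (\<Sum>a\<in>A \<inter> N. of_bool (a \<in> taken (K w) S n))"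
    using finN by (intro sum.mono_neutral_cong_right) auto
  finally show ?thesis .
qed

lemma taken_measurable:
  assumes "\<forall>t. S' t \<subseteq> N"
  shows "(\<lambda>w. taken (K w) S' t) \<in> measurable seeds (count_space UNIV)"
    and "(\<lambda>w. dec (K w) S' t) \<in> measurable seeds (count_space UNIV)"
proof -
  have tN: "taken (K w) S' t \<in> Pow N" for w t
  proof -
    have "a \<in> N" if "dec (K w) S' s = Some a" for a s
      using that assms by (auto simp: dec_Some_iff)
    then show ?thesis by (auto simp: mem_taken_iff)
  qed
  have compose: "(\<lambda>w. f (taken (K w) S' t) w) \<in> measurable seeds (count_space UNIV)"
    if "(\<lambda>w. taken (K w) S' t) \<in> measurable seeds (count_space UNIV)"
      "\<And>T. T \<in> Pow N \<Longrightarrow> f T \<in> measurable seeds (count_space UNIV)" for f t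
  proof (rule measurable_compose_countable'[where I = "Pow N"])
    show "(\<lambda>w. taken (K w) S' t) \<in> measurable seeds (count_space (Pow N))"
      by (subst measurable_count_space_eq2)
        (use finN tN measurable_sets[OF that(1)] in \<open>auto simp del: Pow_iff\<close>)
  qed (use that finN in \<open>auto intro: countable_finite\<close>)
  have dec: "(\<lambda>w. dec (K w) S' t) \<in> measurable seeds (count_space UNIV)"
    if "(\<lambda>w. taken (K w) S' t) \<in> measurable seeds (count_space UNIV)" for t
    unfolding dec_def
  proof (rule compose[OF that])
    have "finite (S' t - T)" "inj_on e (S' t - T)" for T
      using assms by (auto intro: finite_subset[OF _ finN] inj_on_subset[OF inj_e])
    then show "(\<lambda>w. pick e (K w t) (S' t - T)) \<in> measurable seeds (count_space UNIV)" for T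
      by (intro pick_measurable key_measurable)
  qed
  show tk: "(\<lambda>w. taken (K w) S' t) \<in> measurable seeds (count_space UNIV)" for t
  proof (induction t)
    case (Suc t)
    show ?case
      unfolding taken_Suc
      by (rule compose[OF Suc]) (rule measurable_compose[OF dec[OF Suc]], simp)
  qed simp
  show "(\<lambda>w. dec (K w) S' t) \<in> measurable seeds (count_space UNIV)"
    by (rule dec[OF tk])
qed

lemmas taken_S_measurable [measurable] = taken_measurable[OF S_N]
lemmas taken_del_measurable [measurable] = taken_measurable[OF del_S_N]

text \<open>The run without \<open>a\<close> never reads the rank of \<open>a\<close>, so it stays
  fixed while that rank is resampled.\<close>

lemma dec_upd_del: "dec (K (w(Inl a := x))) (del a S) t = dec (K w) (del a S) t"
  by (rule dec_cong) (use S_N in auto)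

end

subsection \<open>Utilitarian welfare\<close>

text \<open>For \<open>y\<close> between \<open>g\<close> and 1, the integral of
  \<open>exp (x - 1)\<close> from \<open>g\<close> to \<open>y\<close> plus
  \<open>1 - exp (y - 1)\<close> equals \<open>1 - exp (g - 1)\<close>, whatever \<open>y\<close>
  is. A constant \<open>c\<close> on low ranks adds \<open>g * c\<close>, while an item served by a
  low agent keeps \<open>1 - c\<close>. Equating the two values gives
  \<open>c = exp (g - 1) / (g + 1)\<close>. The cap at 1 makes the pointwise bounds hold for seeds
  outside the unit interval too.\<close>

definition price :: "real \<Rightarrow> real \<Rightarrow> real" where
  "price g x = (if x < g then exp (g - 1) / (g + 1) else exp (min x 1 - 1))"

lemma price_measurable [measurable]: "price g \<in> borel_measurable borel"
  unfolding price_def by measurable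

lemma low_price_le:
  fixes g :: real
  assumes "0 \<le> g"
  shows "exp (g - 1) / (g + 1) \<le> exp (g - 1)"
  using assms divide_left_mono[of 1 "g + 1" "exp (g - 1)"] by simp

lemma price_bounds:
  assumes "0 \<le> g" "g \<le> 1"
  shows "0 \<le> price g x" "price g x \<le> 1"
proof -
  show "0 \<le> price g x" using assms by (simp add: price_def)
  have "exp (g - 1) / (g + 1) \<le> 1"
    using low_price_le[OF assms(1)] assms by (meson exp_le_one_iff order_trans diff_le_0_iff_le)
  then show "price g x \<le> 1" by (simp add: price_def)
qed

lemma price_mono:
  assumes "0 \<le> g" "g \<le> 1" "x \<le> y"
  shows "price g x \<le> price g y"
proof -
  have "exp (g - 1) \<le> exp (min y 1 - 1)" if "g \<le> y"
    using that assms(2) by simp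
  with low_price_le[OF assms(1)] assms(3) show ?thesis
    unfolding price_def by (auto intro: order_trans)
qed

lemma of_bool_price_measurable:
  "(\<lambda>x. of_bool (x < y) * price g x) \<in> borel_measurable borel"
  by measurable

lemma price_integral:
  assumes g: "0 \<le> g" "g \<le> 1" and y: "g \<le> y"
  shows "(\<integral>x. of_bool (x < y) * price g x \<partial>unit_uniform) + (1 - price g y) = 1 - exp (g - 1) / (g + 1)"
proof -
  define c where "c = exp (g - 1) / (g + 1)"
  define m where "m = min y 1"
  have m: "g \<le> m" "m \<le> 1" using y g by (auto simp: m_def)
  have "has_bochner_integral lborel (\<lambda>x. exp (x - 1) * indicator {g..m} x) (exp (m - 1) - exp (g - 1))"
    by (rule has_bochner_integral_FTC_Icc_real)
       (use m in \<open>auto intro!: derivative_eq_intros continuous_intros\<close>)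
  moreover have "has_bochner_integral lborel (indicator {0..g}) (measure lborel {0..g})"
    by (rule has_bochner_integral_real_indicator) (auto simp: emeasure_lborel_Icc_eq)
  then have "has_bochner_integral lborel (\<lambda>x. indicator {0..g} x * c) (g * c)"
    using g by (intro has_bochner_integral_mult_left) auto
  ultimately have hb: "has_bochner_integral lborel
      (\<lambda>x. indicator {0..g} x * c + exp (x - 1) * indicator {g..m} x) (g * c + (exp (m - 1) - exp (g - 1)))"
    by (intro has_bochner_integral_add)
  have "(\<integral>x. of_bool (x < y) * price g x \<partial>unit_uniform) =
      (\<integral>x. indicator {0..1} x * (of_bool (x < y) * price g x) \<partial>lborel)"
    by (rule integral_unit_uniform[OF of_bool_price_measurable])
  also have "\<dots> = (\<integral>x. indicator {0..g} x * c + exp (x - 1) * indicator {g..m} x \<partial>lborel)"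
  proof (rule integral_cong_AE)
    \<comment> \<open>The half-open ranges of the price and the closed intervals of the
      antiderivative differ only at \<open>g\<close> and \<open>m\<close>.\<close>
    have "AE x in lborel. x \<noteq> g \<and> x \<noteq> m"
      using AE_lborel_singleton[of g] AE_lborel_singleton[of m] by eventually_elim simp
    then show "AE x in lborel. indicator {0..1} x * (of_bool (x < y) * price g x) =
        indicator {0..g} x * c + exp (x - 1) * indicator {g..m} x"
    proof eventually_elim
      case (elim x)
      then show ?case
        using g m y by (auto simp: price_def indicator_def m_def c_def min_def split: if_splits)
    qed
  qed (use of_bool_price_measurable in simp_all)
  also have "\<dots> = g * c + (exp (m - 1) - exp (g - 1))"
    using hb by (rule has_bochner_integral_integral_eq)
  finally have "(\<integral>x. of_bool (x < y) * price g x \<partial>unit_uniform) = g * c + (exp (m - 1) - exp (g - 1))" .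
  moreover have "price g y = exp (m - 1)"
    using y by (simp add: price_def m_def)
  moreover have "g * c + c = exp (g - 1)"
  proof -
    have "g * c + c = (g + 1) * c" by (simp add: algebra_simps)
    then show ?thesis using g by (simp add: c_def)
  qed
  ultimately show ?thesis by (simp add: c_def)
qed

section \<open>Sharing the unit of every matched edge between its agent and its item\<close>

context class_matching_instance
begin

definition agent_share :: "('a + nat \<times> nat \<Rightarrow> real) \<Rightarrow> 'a \<Rightarrow> real" where
  "agent_share w a = of_bool (a \<in> taken (K w) S n) * price g (w (Inl a))"

definition item_share :: "('a + nat \<times> nat \<Rightarrow> real) \<Rightarrow> nat \<Rightarrow> real" where
  "item_share w t = (case dec (K w) S t of None \<Rightarrow> 0 | Some b \<Rightarrow> 1 - price g (w (Inl b)))"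

lemma usw_shares: "usw (X w) = (\<Sum>a\<in>N. agent_share w a) + (\<Sum>t<n. item_share w t)"
proof -
  have "usw (X w) = (\<Sum>t<n. case dec (K w) S t of None \<Rightarrow> 0 | Some b \<Rightarrow> 1)"
    using card_X[of w UNIV] by (simp add: usw_def cong: option.case_cong)
  also have "\<dots> = (\<Sum>t<n. (case dec (K w) S t of None \<Rightarrow> 0 | Some b \<Rightarrow> price g (w (Inl b))) + item_share w t)"
    by (intro sum.cong) (auto simp: item_share_def split: option.splits)
  finally show ?thesis
    by (simp add: sum.distrib agent_share_def sum_taken)
qed

lemma share_bounds:
  "0 \<le> agent_share w a" "agent_share w a \<le> 1" "0 \<le> item_share w t" "item_share w t \<le> 1"
  using price_bounds[OF g0 g1]
  by (auto simp: agent_share_def item_share_def split: option.splits)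

lemma agent_share_measurable [measurable]: "(\<lambda>w. agent_share w a) \<in> borel_measurable seeds"
proof -
  have [measurable]: "Measurable.pred seeds (\<lambda>w. a \<in> taken (K w) S n)"
    by (rule measurable_compose[OF taken_S_measurable(1)]) simp
  show ?thesis unfolding agent_share_def by measurable
qed

lemma dec_eq_measurable [measurable]:
  "Measurable.pred seeds (\<lambda>w. dec (K w) S t = d)"
  "Measurable.pred seeds (\<lambda>w. dec (K w) (del a S) t = d)"
  by (rule measurable_compose[OF taken_S_measurable(2)], simp)
     (rule measurable_compose[OF taken_del_measurable(2)], simp)

lemma item_share_eq:
  "item_share w t = (\<Sum>b\<in>N. of_bool (dec (K w) S t = Some b) * (1 - price g (w (Inl b))))"
proof (cases "dec (K w) S t")
  case (Some b)
  have "(\<Sum>a\<in>N. of_bool (b = a) * (1 - price g (w (Inl a)))) =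
      (\<Sum>a\<in>N. if b = a then 1 - price g (w (Inl a)) else 0)"
    by (rule sum.cong) auto
  then show ?thesis
    using dec_N[OF Some] finN Some by (simp add: item_share_def)
qed (simp add: item_share_def)

lemma item_share_measurable [measurable]: "(\<lambda>w. item_share w t) \<in> borel_measurable seeds"
  unfolding item_share_eq by measurable

text \<open>All seeds except the rank \<open>x\<close> of \<open>a\<close> are fixed, hence so is
  the run without \<open>a\<close>. Let \<open>y\<close> be the rank of the agent serving
  \<open>t\<close> there. If \<open>y\<close> is not low, \<open>a\<close> collects
  \<open>price g x\<close> whenever \<open>x < y\<close>, the item collects at least
  \<open>1 - price g y\<close>, and \<open>price_integral\<close> averages the two. If
  \<open>y\<close> is low, the share of the item alone suffices.\<close>

lemma edge_share_ge:
  assumes a: "a \<in> S t" and t: "t < n"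
  shows "1 - exp (g - 1) / (g + 1) \<le>
    (\<integral>x. agent_share (w(Inl a := x)) a + item_share (w(Inl a := x)) t \<partial>unit_uniform)"
proof -
  let ?w = "\<lambda>x. w(Inl a := x)"
  let ?d = "dec (K w) (del a S) t"
  note pb = price_bounds[OF g0 g1]
  have int: "integrable unit_uniform (\<lambda>x. agent_share (?w x) a + item_share (?w x) t)"
  proof (rule unit_uniform.integrable_const_bound[where B = 2])
    have "norm (agent_share (?w x) a + item_share (?w x) t) \<le> 2" for x
      using share_bounds(1,2)[of "?w x" a] share_bounds(3,4)[of "?w x" t] by simp
    then show "AE x in unit_uniform. norm (agent_share (?w x) a + item_share (?w x) t) \<le> 2"
      by simp
  qed measurable
  \<comment> \<open>The rival must not be low, since among low agents the lottery decides. Against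
    any other rival a smaller rank gives a smaller key.\<close>
  have wins: "price g x \<le> agent_share (?w x) a"
    if "\<And>b. ?d = Some b \<Longrightarrow> g \<le> w (Inl b) \<and> x < w (Inl b)" for x
  proof -
    have "a \<in> taken (K (?w x)) S (Suc t)"
    proof (rule taken_if_better[OF S_N a])
      fix b assume "dec (K (?w x)) (del a S) t = Some b"
      then have b: "?d = Some b" by (simp add: dec_upd_del)
      then have "b \<noteq> a" using del_S_N by (auto simp: dec_Some_iff)
      then have "K (?w x) t b = w (Inl b)"
        using that[OF b] by (simp add: key_def)
      moreover have "K (?w x) t a < w (Inl b)"
        using that[OF b] low_key_neg[of "?w x" t a] g0 by (auto simp: key_def)
      ultimately show "better e (K (?w x) t) a b" by (simp add: better_def)
    qed
    then have "a \<in> taken (K (?w x)) S n"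
      using taken_mono[of "Suc t" n "K (?w x)" S] t by auto
    then show ?thesis by (simp add: agent_share_def)
  qed
  have item: "1 - price g (w (Inl b)) \<le> item_share (?w x) t" if b: "?d = Some b" for b x
  proof -
    have nb: "b \<noteq> a" using b del_S_N by (auto simp: dec_Some_iff)
    obtain c where c: "dec (K (?w x)) S t = Some c" "c = b \<or> better e (K (?w x) t) c b"
      using dec_del_better[OF S_N, of "K (?w x)" a t b] b by (auto simp: dec_upd_del)
    have le: "K (?w x) t c \<le> K (?w x) t b"
      using c(2) by (auto simp: better_def)
    \<comment> \<open>Keys of low agents follow tickets rather than ranks, but the price is constant
      on low ranks, so a smaller key never carries a larger price.\<close>
    have "price g (?w x (Inl c)) \<le> price g (?w x (Inl b))"
    proof (cases "?w x (Inl b) < g")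
      case True
      then have "?w x (Inl c) < g"
        using le key_neg_iff[of "?w x" t b] key_neg_iff[of "?w x" t c] by linarith
      with True show ?thesis unfolding price_def by simp
    next
      case False
      then have "?w x (Inl c) \<le> ?w x (Inl b)"
        using le g0 unfolding key_def by (auto split: if_splits)
      then show ?thesis by (rule price_mono[OF g0 g1])
    qed
    then show ?thesis using c(1) nb by (simp add: item_share_def)
  qed
  have main: ?thesis
    if y: "g \<le> y" and le: "\<And>x. of_bool (x < y) * price g x + (1 - price g y) \<le>
      agent_share (?w x) a + item_share (?w x) t" for y
  proof -
    have i: "integrable unit_uniform (\<lambda>x. of_bool (x < y) * price g x)"
      by (rule unit_uniform.integrable_const_bound[where B = 1])
         (use pb of_bool_price_measurable in
           \<open>auto simp: measurable_cong_sets[OF sets_unit_uniform refl] abs_mult\<close>)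
    have "1 - exp (g - 1) / (g + 1) = (\<integral>x. of_bool (x < y) * price g x + (1 - price g y) \<partial>unit_uniform)"
      using i price_integral[OF g0 g1 y] unit_uniform.prob_space by simp
    also have "\<dots> \<le> (\<integral>x. agent_share (?w x) a + item_share (?w x) t \<partial>unit_uniform)"
      by (rule integral_mono) (use i int le in auto)
    finally show ?thesis .
  qed
  show ?thesis
  proof (cases ?d)
    case None
    \<comment> \<open>An unserved item behaves as if served at a rank beyond all others:
      \<open>2\<close> exceeds every rank in the unit interval, and its price is 1, so nothing is
      claimed from the item.\<close>
    show ?thesis
    proof (rule main[of 2])
      show "of_bool (x < 2) * price g x + (1 - price g 2) \<le> agent_share (?w x) a + item_share (?w x) t" for x
        using wins[of x] None share_bounds(3)[of "?w x" t] pb(1)[of x] g1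
        by (cases "x < 2") (auto simp: price_def[of g 2])
    qed (use g1 in simp)
  next
    case (Some b)
    show ?thesis
    proof (cases "w (Inl b) < g")
      case True
      have "(\<integral>x. 1 - exp (g - 1) / (g + 1) \<partial>unit_uniform) \<le>
          (\<integral>x. agent_share (?w x) a + item_share (?w x) t \<partial>unit_uniform)"
      proof (rule integral_mono)
        show "1 - exp (g - 1) / (g + 1) \<le> agent_share (?w x) a + item_share (?w x) t" for x
          using item[OF Some, of x] True share_bounds(1)[of "?w x" a] by (simp add: price_def)
      qed (use int in auto)
      then show ?thesis using unit_uniform.prob_space by simp
    next
      case False
      show ?thesis
      proof (rule main[of "w (Inl b)"])
        show "of_bool (x < w (Inl b)) * price g x + (1 - price g (w (Inl b))) \<le>
            agent_share (?w x) a + item_share (?w x) t" for x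
          using item[OF Some, of x] wins[of x] Some False share_bounds(1)[of "?w x" a]
          by (cases "x < w (Inl b)") auto
      qed (use False in simp)
    qed
  qed
qed

text \<open>The edges of \<open>Xs\<close> have distinct agents and distinct items, so the shares
  collected along them are part of the total, which is \<open>usw (X w)\<close>.\<close>

lemma usw_bound:
  assumes Xs: "is_matching E Xs"
  shows "(1 - exp (g - 1) / (g + 1)) * usw Xs \<le> (\<integral>w. usw (X w) \<partial>seeds)"
proof -
  have fin: "finite Xs"
    using Xs E_sub finM finN by (auto simp: is_matching_def intro: finite_subset[of Xs "M \<times> N"])
  define idx where "idx x = (THE t. t < n \<and> os ! t = x)" for x
  have idx: "idx x < n" "os ! idx x = x" if x: "x \<in> M" for x
  proof -
    have "\<exists>!t. t < n \<and> os ! t = x"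
      using x set_os dist_os by (metis distinct_Ex1)
    from theI'[OF this] show "idx x < n" "os ! idx x = x"
      by (auto simp: idx_def)
  qed
  have inN: "snd p \<in> N" "fst p \<in> M" "snd p \<in> S (idx (fst p))" if p: "p \<in> Xs" for p
  proof -
    have pE: "p \<in> E" using p Xs by (auto simp: is_matching_def)
    then show pM: "fst p \<in> M" and pN: "snd p \<in> N" using E_sub by auto
    show "snd p \<in> S (idx (fst p))"
      using idx[OF pM] pN pE by (simp add: S_def)
  qed
  have inj1: "inj_on snd Xs"
    using Xs by (auto simp: inj_on_def is_matching_def)
  have inj2: "inj_on (\<lambda>p. idx (fst p)) Xs"
  proof (rule inj_onI)
    fix p q assume pq: "p \<in> Xs" "q \<in> Xs" "idx (fst p) = idx (fst q)"
    then have "fst p = fst q" using idx(2) inN(2) by metis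
    then show "p = q" using pq Xs by (auto simp: is_matching_def prod_eq_iff) (metis prod.collapse)
  qed
  have i1: "integrable seeds (\<lambda>w. agent_share w a)" for a
    by (rule seeds.integrable_const_bound[where B = 1]) (use share_bounds in auto)
  have i2: "integrable seeds (\<lambda>w. item_share w t)" for t
    by (rule seeds.integrable_const_bound[where B = 1]) (use share_bounds in auto)
  have "(1 - exp (g - 1) / (g + 1)) * usw Xs = (\<Sum>p\<in>Xs. 1 - exp (g - 1) / (g + 1))"
    by (simp add: usw_def)
  also have "\<dots> \<le> (\<Sum>p\<in>Xs. \<integral>w. agent_share w (snd p) + item_share w (idx (fst p)) \<partial>seeds)"
  proof (rule sum_mono)
    fix p assume p: "p \<in> Xs"
    show "1 - exp (g - 1) / (g + 1) \<le> (\<integral>w. agent_share w (snd p) + item_share w (idx (fst p)) \<partial>seeds)"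
    proof (rule integral_resample_ge[where B = 2])
      show "\<bar>agent_share w (snd p) + item_share w (idx (fst p))\<bar> \<le> 2" for w
        using share_bounds(1,2)[of w "snd p"] share_bounds(3,4)[of w "idx (fst p)"] by linarith
      show "1 - exp (g - 1) / (g + 1) \<le> (\<integral>x. agent_share (w(Inl (snd p) := x)) (snd p) +
          item_share (w(Inl (snd p) := x)) (idx (fst p)) \<partial>unit_uniform)" for w
        using inN[OF p] idx by (intro edge_share_ge) auto
    qed measurable
  qed
  also have "\<dots> = (\<integral>w. (\<Sum>p\<in>Xs. agent_share w (snd p) + item_share w (idx (fst p))) \<partial>seeds)"
    using i1 i2 by (intro Bochner_Integration.integral_sum[symmetric]) auto
  also have "\<dots> \<le> (\<integral>w. usw (X w) \<partial>seeds)"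
  proof (rule integral_mono)
    show "integrable seeds (\<lambda>w. usw (X w))" by (rule mixture.integrable_det_run)
    fix w
    have "(\<Sum>p\<in>Xs. agent_share w (snd p)) = (\<Sum>a\<in>snd ` Xs. agent_share w a)"
      using inj1 by (simp add: sum.reindex)
    also have "\<dots> \<le> (\<Sum>a\<in>N. agent_share w a)"
      using finN inN(1) share_bounds(1) by (intro sum_mono2) auto
    finally have A: "(\<Sum>p\<in>Xs. agent_share w (snd p)) \<le> (\<Sum>a\<in>N. agent_share w a)" .
    have "(\<Sum>p\<in>Xs. item_share w (idx (fst p))) = (\<Sum>t\<in>(\<lambda>p. idx (fst p)) ` Xs. item_share w t)"
      using inj2 by (simp add: sum.reindex)
    also have "\<dots> \<le> (\<Sum>t<n. item_share w t)"
      using inN(2) idx(1) share_bounds(3) by (intro sum_mono2) auto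
    finally show "(\<Sum>p\<in>Xs. agent_share w (snd p) + item_share w (idx (fst p))) \<le> usw (X w)"
      using A by (simp add: usw_shares sum.distrib)
  qed (use i1 i2 in auto)
  finally show ?thesis .
qed

end

subsection \<open>Class envy-freeness\<close>

text \<open>Weak duality for a fractional vertex cover. Items with \<open>y x = 0\<close> carry no
  flow, so only edges at items with \<open>y x = 1\<close> have to be covered.\<close>

lemma Vstar_le_cover:
  assumes finM: "finite M" and finN: "finite N" and y: "\<And>x. y x \<in> {0, 1}"
    and \<alpha>: "\<And>a. 0 \<le> \<alpha> a" and \<beta>: "\<And>x. 0 \<le> \<beta> x"
    and cover: "\<And>x a. (x, a) \<in> E \<Longrightarrow> x \<in> M \<Longrightarrow> a \<in> class_of N cls i \<Longrightarrow> y x = 1 \<Longrightarrow> 1 \<le> \<alpha> a + \<beta> x"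
  shows "Vstar N cls M E i y \<le> (\<Sum>a\<in>class_of N cls i. \<alpha> a) + (\<Sum>x\<in>M. \<beta> x)"
  unfolding Vstar_def
proof (rule cSup_least)
  have "frac_matching (class_of N cls i) M E y (\<lambda>_. 0)"
    using y by (auto simp: frac_matching_def) (metis insert_iff empty_iff order_refl zero_le_one)
  then show "{(\<Sum>e\<in>E \<inter> (M \<times> class_of N cls i). f e) | f. frac_matching (class_of N cls i) M E y f} \<noteq> {}"
    by blast
next
  let ?A = "class_of N cls i"
  have finA: "finite ?A" using finN by (simp add: class_of_def)
  fix v assume "v \<in> {(\<Sum>e\<in>E \<inter> (M \<times> ?A). f e) | f. frac_matching ?A M E y f}"
  then obtain f where v: "v = (\<Sum>e\<in>E \<inter> (M \<times> ?A). f e)" and f: "frac_matching ?A M E y f" by blast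
  from f have f0: "\<And>e. 0 \<le> f e" and fE: "\<And>e. e \<notin> E \<inter> (M \<times> ?A) \<Longrightarrow> f e = 0"
    and fx: "\<And>x. x \<in> M \<Longrightarrow> (\<Sum>a\<in>?A. f (x, a)) \<le> y x"
    and fa: "\<And>a. a \<in> ?A \<Longrightarrow> (\<Sum>x\<in>M. f (x, a)) \<le> 1"
    unfolding frac_matching_def by auto
  have edge: "f (x, a) \<le> f (x, a) * \<alpha> a + f (x, a) * \<beta> x" if xa: "x \<in> M" "a \<in> ?A" for x a
  proof (cases "(x, a) \<in> E \<and> y x = 1")
    case True
    then have "f (x, a) * 1 \<le> f (x, a) * (\<alpha> a + \<beta> x)"
      using xa cover f0 by (intro mult_left_mono) auto
    then show ?thesis by (simp add: algebra_simps)
  next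
    case False
    have "f (x, a) \<le> (\<Sum>a\<in>?A. f (x, a))"
      using finA xa f0 by (intro member_le_sum) auto
    with False fx[OF xa(1)] fE[of "(x, a)"] f0[of "(x, a)"] y[of x] have "f (x, a) = 0"
      by (auto intro: antisym)
    then show ?thesis by simp
  qed
  have "v = (\<Sum>e\<in>M \<times> ?A. f e)"
    unfolding v using finM finA fE by (intro sum.mono_neutral_left) auto
  also have "\<dots> = (\<Sum>x\<in>M. \<Sum>a\<in>?A. f (x, a))"
    by (simp add: sum.cartesian_product)
  also have "\<dots> \<le> (\<Sum>x\<in>M. \<Sum>a\<in>?A. f (x, a) * \<alpha> a + f (x, a) * \<beta> x)"
    by (intro sum_mono edge)
  also have "\<dots> = (\<Sum>a\<in>?A. (\<Sum>x\<in>M. f (x, a)) * \<alpha> a) + (\<Sum>x\<in>M. (\<Sum>a\<in>?A. f (x, a)) * \<beta> x)"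
    using sum.swap[of "\<lambda>x a. f (x, a) * \<alpha> a" ?A M] by (simp add: sum.distrib sum_distrib_right)
  also have "\<dots> \<le> (\<Sum>a\<in>?A. 1 * \<alpha> a) + (\<Sum>x\<in>M. 1 * \<beta> x)"
  proof (intro add_mono sum_mono mult_right_mono \<alpha> \<beta> fa)
    show "(\<Sum>a\<in>?A. f (x, a)) \<le> 1" if "x \<in> M" for x
      using fx[OF that] y[of x] by auto
  qed
  finally show "v \<le> (\<Sum>a\<in>?A. \<alpha> a) + (\<Sum>x\<in>M. \<beta> x)" by simp
qed

section \<open>Stuck agents and the influence of their own ranks\<close>

context class_matching_instance
begin

abbreviation stuck :: "('a + nat \<times> nat \<Rightarrow> real) \<Rightarrow> 'a \<Rightarrow> bool" where
  "stuck w a \<equiv> blocked (L w) (K w) S n a"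

abbreviation gets :: "nat \<Rightarrow> nat \<Rightarrow> ('a + nat \<times> nat \<Rightarrow> real) \<Rightarrow> bool" where
  "gets i t w \<equiv> \<exists>b\<in>class_of N cls i. dec (K w) S t = Some b"

lemma taken_mem_measurable [measurable]: "Measurable.pred seeds (\<lambda>w. a \<in> taken (K w) S t)"
  by (rule measurable_compose[OF taken_S_measurable(1)]) simp

lemma finite_class: "finite (class_of N cls i)"
  using finN by (simp add: class_of_def)

lemma gets_measurable [measurable]: "Measurable.pred seeds (gets i t)"
  using finite_class by measurable

lemma stuck_measurable [measurable]: "Measurable.pred seeds (\<lambda>w. stuck w a)"
proof -
  have "stuck w a \<longleftrightarrow> (\<forall>t<n. a \<in> S t \<longrightarrow> (\<exists>b\<in>N. dec (K w) (del a S) t = Some b \<and>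
      (K w t b < L w t a \<or> K w t b = L w t a \<and> e b < e a)))" for w
  proof -
    have "b \<in> N" if "dec (K w) (del a S) t = Some b" for b t
      using that S_N del_S_N[of a] by (auto simp: dec_Some_iff)
    then show ?thesis unfolding blocked_def by blast
  qed
  moreover have [measurable]: "Measurable.pred seeds (\<lambda>w. K w t b = L w t a)" for t b
    unfolding pred_def by (rule borel_measurable_eq) measurable
  have "Measurable.pred seeds (\<lambda>w. \<forall>t<n. a \<in> S t \<longrightarrow> (\<exists>b\<in>N. dec (K w) (del a S) t = Some b \<and>
      (K w t b < L w t a \<or> K w t b = L w t a \<and> e b < e a)))"
    using finN by measurable
  ultimately show ?thesis by (simp only:)
qed

text \<open>\<open>blocked\<close> consults the run without \<open>a\<close> and, through
  \<open>L\<close>, the ticket of its class; neither involves the rank of \<open>a\<close>.\<close>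

lemma stuck_upd_self: "stuck (w(Inl a := x)) a \<longleftrightarrow> stuck w a"
proof -
  have "b \<noteq> a" if "dec (K w) (del a S) t = Some b" for b t
    using that del_S_N by (auto simp: dec_Some_iff)
  then show ?thesis
    unfolding blocked_def dec_upd_del low_key_upd using key_upd by metis
qed

lemma stuck_untaken: "stuck w a \<Longrightarrow> t \<le> n \<Longrightarrow> a \<notin> taken (K w) S t"
  by (rule blocked_untaken[OF S_N, where l = "L w" and n = n]) (auto intro: low_key_le)

lemma stuck_dec_del: "stuck w a \<Longrightarrow> t < n \<Longrightarrow> dec (K w) (del a S) t = dec (K w) S t"
  using stuck_untaken[of w a "Suc t"] by (intro dec_del_eq[OF S_N]) auto

text \<open>Under either rank \<open>a\<close> stays free, so both runs agree with the run without
  \<open>a\<close>.\<close>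

lemma stuck_upd_dec:
  assumes "stuck w a" "t < n"
  shows "dec (K (w(Inl a := x))) S t = dec (K w) S t"
  using stuck_dec_del[OF assms] stuck_dec_del[of "w(Inl a := x)" a t] assms
  by (simp add: stuck_upd_self dec_upd_del)

text \<open>The decisions do not change, and \<open>a\<close> never wins an item, so the keys of all
  winners are unchanged too. In the form \<open>blocked_iff\<close>, stuckness of \<open>b\<close>
  depends only on these and on tickets.\<close>

lemma stuck_upd:
  assumes a: "stuck w a"
  shows "stuck (w(Inl a := x)) b \<longleftrightarrow> stuck w b"
proof (cases "b = a")
  case True
  then show ?thesis by (simp add: stuck_upd_self)
next
  case False
  let ?w = "w(Inl a := x)"
  define Q where "Q v t \<longleftrightarrow> (\<exists>c. dec (K v) S t = Some c \<and>
      (K v t c < L v t b \<or> K v t c = L v t b \<and> e c < e b))" for v t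
  have iff: "stuck v b \<longleftrightarrow> b \<notin> taken (K v) S n \<and> (\<forall>t<n. b \<in> S t \<longrightarrow> Q v t)" for v
    unfolding Q_def by (intro blocked_iff[OF S_N] low_key_le)
  have tk: "taken (K ?w) S n = taken (K w) S n"
    using stuck_upd_dec[OF a] unfolding mem_taken_iff set_eq_iff by auto
  have "Q ?w t \<longleftrightarrow> Q w t" if t: "t < n" for t
  proof (cases "dec (K w) S t")
    case None
    then show ?thesis using stuck_upd_dec[OF a t, of x] by (simp add: Q_def)
  next
    case (Some c)
    then have "c \<noteq> a"
      using stuck_untaken[OF a order_refl] t by (auto simp: mem_taken_iff)
    then show ?thesis
      using Some stuck_upd_dec[OF a t, of x] by (simp add: Q_def low_key_upd)
  qed
  then show ?thesis unfolding iff tk by blast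
qed

text \<open>Stuckness is independent of the agent's own rank, which is low with probability
  \<open>g\<close>. For a low agent the actual key is the low key, so
  \<open>not_blocked_taken\<close> applies.\<close>

lemma prob_not_stuck:
  "g * measure seeds {w. \<not> stuck w a} \<le> measure seeds {w. a \<in> taken (K w) S n}"
proof -
  have "g * measure seeds {w. \<not> stuck w a} = measure seeds {w. \<not> stuck w a \<and> w (Inl a) < g}"
    by (rule prob_less_independent[symmetric]) (use g0 g1 in \<open>auto simp: stuck_upd_self\<close>)
  also have "\<dots> \<le> measure seeds {w. a \<in> taken (K w) S n}"
  proof (rule seeds.finite_measure_mono)
    show "{w. \<not> stuck w a \<and> w (Inl a) < g} \<subseteq> {w. a \<in> taken (K w) S n}"
      by (auto intro!: not_blocked_taken[OF S_N, where l = "L _"] simp: key_def)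
    show "{w. a \<in> taken (K w) S n} \<in> sets seeds"
      using taken_mem_measurable[of a n] by (simp add: pred_def)
  qed
  finally show ?thesis .
qed

text \<open>The available low agent of class \<open>i\<close> forces the recipient to be low as
  well, so for distinct classes the tickets alone put \<open>j\<close> ahead of
  \<open>i\<close>.\<close>

definition contested :: "nat \<Rightarrow> nat \<Rightarrow> nat \<Rightarrow> ('a + nat \<times> nat \<Rightarrow> real) \<Rightarrow> bool" where
  "contested i j t w \<longleftrightarrow> gets j t w \<and>
     (\<exists>a\<in>class_of N cls i. a \<in> S t \<and> w (Inl a) < g \<and> a \<notin> taken (K w) S t)"

lemma contested_measurable [measurable]: "Measurable.pred seeds (contested i j t)"
  unfolding contested_def using finite_class by measurable

text \<open>Several stuck agents may like the item; selecting the least in the numbering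
  \<open>e\<close> makes the events disjoint. By \<open>stuck_upd\<close> the selection ignores the
  rank of the selected agent, which is thus low with probability \<open>g\<close>; being stuck, that
  agent is still free at \<open>t\<close>.\<close>

lemma prob_stuck_le_contested:
  assumes t: "t < n"
  shows "g * measure seeds {w. gets j t w \<and> (\<exists>a\<in>class_of N cls i. a \<in> S t \<and> stuck w a)} \<le>
    measure seeds {w. contested i j t w}"
proof -
  let ?A = "class_of N cls i"
  define first where "first a w \<longleftrightarrow> gets j t w \<and> a \<in> S t \<and> stuck w a \<and>
      (\<forall>b\<in>?A. b \<in> S t \<longrightarrow> stuck w b \<longrightarrow> e a \<le> e b)" for a w
  have meas [measurable]: "Measurable.pred seeds (first a)" for a
    unfolding first_def using finite_class by measurable
  have upd: "first a (w(Inl a := x))" if "first a w" for a w x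
    using that stuck_upd_dec[of w a t x] stuck_upd[of w a x] t unfolding first_def by simp
  \<comment> \<open>Writing back the old rank undoes the update, which yields the converse
    implication.\<close>
  have inv: "first a (w(Inl a := x)) = first a w" for a w x
    using upd[of a w x] upd[of a "w(Inl a := x)" "w (Inl a)"] by auto
  have cover: "{w. gets j t w \<and> (\<exists>a\<in>?A. a \<in> S t \<and> stuck w a)} \<subseteq> (\<Union>a\<in>?A. {w. first a w})"
  proof (clarify)
    fix w a b assume *: "b \<in> class_of N cls j" "dec (K w) S t = Some b" "a \<in> ?A" "a \<in> S t" "stuck w a"
    let ?B = "{a \<in> ?A. a \<in> S t \<and> stuck w a}"
    have B: "finite ?B" "?B \<noteq> {}" using finite_class * by auto
    obtain c where c: "c \<in> ?B" "\<And>b. b \<in> ?B \<Longrightarrow> e c \<le> e b"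
      using that[OF arg_min_if_finite(1)[OF B, of e] arg_min_least[OF B, of _ e]] .
    have "first c w"
      unfolding first_def using *(1,2) c by simp
    moreover have "c \<in> ?A" using c(1) by simp
    ultimately show "w \<in> (\<Union>a\<in>?A. {w. first a w})" by blast
  qed
  have first_sets: "{w. first a w} \<in> sets seeds" for a
    using meas[of a] by (simp add: pred_def)
  have "Measurable.pred seeds (\<lambda>w. first a w \<and> w (Inl a) < g)" for a by measurable
  then have low_sets: "{w. first a w \<and> w (Inl a) < g} \<in> sets seeds" for a
    by (simp add: pred_def)
  have contested_sets: "{w. contested i j t w} \<in> sets seeds"
    using contested_measurable[of i j t] by (simp add: pred_def)
  have "measure seeds {w. gets j t w \<and> (\<exists>a\<in>?A. a \<in> S t \<and> stuck w a)} \<le>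
      measure seeds (\<Union>a\<in>?A. {w. first a w})"
    by (rule seeds.finite_measure_mono[OF cover]) (intro sets.finite_UN finite_class first_sets)
  also have "\<dots> \<le> (\<Sum>a\<in>?A. measure seeds {w. first a w})"
    by (rule seeds.finite_measure_subadditive_finite[OF finite_class]) (use first_sets in blast)
  finally have "g * measure seeds {w. gets j t w \<and> (\<exists>a\<in>?A. a \<in> S t \<and> stuck w a)} \<le>
      g * (\<Sum>a\<in>?A. measure seeds {w. first a w})"
    using g0 by (rule mult_left_mono)
  also have "\<dots> = (\<Sum>a\<in>?A. measure seeds {w. first a w \<and> w (Inl a) < g})"
    unfolding sum_distrib_left
    by (intro sum.cong refl prob_less_independent[OF meas, symmetric] inv g0 g1)
  also have "\<dots> = measure seeds (\<Union>a\<in>?A. {w. first a w \<and> w (Inl a) < g})"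
  proof (rule seeds.finite_measure_finite_Union[symmetric, OF finite_class])
    have "a = b" if "a \<in> ?A" "b \<in> ?A" "first a w" "first b w" for a b w
    proof -
      have "e a \<le> e b" "e b \<le> e a"
        using that unfolding first_def by blast+
      moreover have "a \<in> N" "b \<in> N"
        using that(1,2) by (auto simp: class_of_def)
      ultimately show ?thesis
        using inj_onD[OF inj_e, of a b] by simp
    qed
    then show "disjoint_family_on (\<lambda>a. {w. first a w \<and> w (Inl a) < g}) ?A"
      unfolding disjoint_family_on_def by blast
  qed (use low_sets in blast)
  also have "\<dots> \<le> measure seeds {w. contested i j t w}"
  proof (rule seeds.finite_measure_mono[OF _ contested_sets])
    show "(\<Union>a\<in>?A. {w. first a w \<and> w (Inl a) < g}) \<subseteq> {w. contested i j t w}"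
    proof (clarify)
      fix w a assume "a \<in> ?A" "first a w" "w (Inl a) < g"
      moreover from this have "a \<notin> taken (K w) S t"
        using stuck_untaken[of w a t] t unfolding first_def by simp
      ultimately show "contested i j t w"
        unfolding first_def contested_def by blast
    qed
  qed
  finally show ?thesis .
qed

section \<open>Exchanging the tickets of two classes\<close>

definition swap :: "nat \<Rightarrow> nat \<Rightarrow> nat \<Rightarrow> 'a + nat \<times> nat \<Rightarrow> 'a + nat \<times> nat" where
  "swap i j t = Transposition.transpose (Inr (t, i)) (Inr (t, j))"

text \<open>Earlier items do not consult the exchanged tickets, so the same agents are free at
  \<open>t\<close>. The best ticket among the available low agents passes from \<open>j\<close> to
  \<open>i\<close>, whose low agent is available to use it.\<close>

lemma contested_swap:
  assumes ij: "i \<noteq> j" and c: "contested i j t w"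
    and distinct: "\<And>l. l \<noteq> j \<Longrightarrow> w (Inr (t, j)) \<noteq> w (Inr (t, l))"
  shows "gets i t (w \<circ> swap i j t)"
proof -
  let ?w = "w \<circ> swap i j t"
  obtain a b where a: "cls a = i" "a \<in> S t" "w (Inl a) < g" "a \<notin> taken (K w) S t"
    and b: "cls b = j" "dec (K w) S t = Some b"
    using c by (auto simp: contested_def class_of_def)
  have Inl: "?w (Inl x) = w (Inl x)" for x
    by (simp add: swap_def)
  have Inr: "?w (Inr (t, l)) = (if l = i then w (Inr (t, j)) else if l = j then w (Inr (t, i)) else w (Inr (t, l)))" for l
    by (simp add: swap_def transpose_def)
  have Inr': "?w (Inr (s, l)) = w (Inr (s, l))" if "s \<noteq> t" for s l
    using that by (simp add: swap_def transpose_def)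
  have taken: "taken (K ?w) S t = taken (K w) S t"
    by (rule taken_cong[OF _ S_N]) (use Inl Inr' in \<open>simp add: key_def low_key_def del: comp_apply\<close>)
  have "dec (K ?w) S t \<noteq> None"
    using a taken by (auto simp: dec_None_iff)
  then obtain d where d: "dec (K ?w) S t = Some d" by auto
  have dS: "d \<in> S t" "d \<notin> taken (K w) S t"
    using d taken by (auto simp: dec_Some_iff S_N)
  have best: "K w t b \<le> K w t x" if "x \<in> S t" "x \<notin> taken (K w) S t" for x
    using b(2) that by (cases "x = b") (auto simp: dec_Some_iff S_N better_def)
  have best': "K ?w t d \<le> K ?w t x" if "x \<in> S t" "x \<notin> taken (K w) S t" for x
    using d that taken by (cases "x = d") (auto simp: dec_Some_iff S_N better_def)
  have lowb: "w (Inl b) < g"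
    using best[OF a(2,4)] a(3) key_neg_iff[of w t a] key_neg_iff[of w t b] by linarith
  have Kb: "K w t b = - exp (w (Inr (t, j)))"
    using lowb b(1) by (simp add: key_def low_key_def)
  have Ka: "K ?w t a = - exp (w (Inr (t, j)))"
    using a(1,3) Inl[of a] Inr[of i] by (simp add: key_def low_key_def del: comp_apply)
  have lowd: "w (Inl d) < g"
    using best'[OF a(2,4)] Ka key_neg_iff[of ?w t d] Inl[of d] exp_gt_zero[of "w (Inr (t, j))"] by linarith
  have "cls d = i"
  proof (rule ccontr)
    assume di: "cls d \<noteq> i"
    \<comment> \<open>After the exchange \<open>d\<close> plays the former ticket of class
      \<open>l\<close>. Before it, an available low agent (\<open>a\<close> if \<open>d\<close> is
      in class \<open>j\<close>, otherwise \<open>d\<close>) held that ticket and did not beat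
      \<open>b\<close>. As \<open>d\<close> now does not lose to \<open>a\<close>, the tickets of
      \<open>j\<close> and \<open>l\<close> would coincide.\<close>
    define l where "l = (if cls d = j then i else cls d)"
    have lj: "l \<noteq> j" using ij by (auto simp: l_def)
    have "K ?w t d = - exp (w (Inr (t, l)))"
      using lowd Inl[of d] Inr[of "cls d"] di by (simp add: key_def low_key_def l_def del: comp_apply)
    then have 1: "w (Inr (t, j)) \<le> w (Inr (t, l))"
      using best'[OF a(2,4)] Ka by simp
    have "K w t (if cls d = j then a else d) = - exp (w (Inr (t, l)))"
      using lowd a by (simp add: key_def low_key_def l_def)
    moreover have "K w t b \<le> K w t (if cls d = j then a else d)"
      using best a dS by simp
    ultimately have "w (Inr (t, l)) \<le> w (Inr (t, j))"
      using Kb by simp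
    with 1 distinct[OF lj] show False by simp
  qed
  then show ?thesis using d dS(1) S_N by (auto simp: class_of_def)
qed

text \<open>The exchange preserves the law of the seeds, and almost surely the ticket of
  \<open>j\<close> at \<open>t\<close> differs from all others, so \<open>contested_swap\<close>
  applies.\<close>

lemma prob_contested_le: "measure seeds {w. contested i j t w} \<le> measure seeds {w. gets i t w}"
proof (cases "i = j")
  case True
  have "{w. gets i t w} \<in> sets seeds"
    using gets_measurable[of i t] by (simp add: pred_def)
  with True show ?thesis
    by (intro seeds.finite_measure_mono) (auto simp: contested_def)
next
  case False
  have inj: "inj (swap i j t)"
    unfolding swap_def by (rule inj_transpose)
  have m: "(\<lambda>w. w \<circ> swap i j t) \<in> measurable seeds (seeds :: ('a + nat \<times> nat \<Rightarrow> real) measure)"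
    by (rule reindex_measurable)
  have "AE w in seeds. \<forall>l. l \<noteq> j \<longrightarrow> w (Inr (t, j) :: 'a + nat \<times> nat) \<noteq> w (Inr (t, l))"
    unfolding AE_all_countable
  proof
    fix l
    show "AE w in seeds. l \<noteq> j \<longrightarrow> w (Inr (t, j) :: 'a + nat \<times> nat) \<noteq> w (Inr (t, l))"
      using AE_seeds_distinct[of "Inr (t, j) :: 'a + nat \<times> nat" "Inr (t, l)"] by (cases "l = j") auto
  qed
  then have "AE w in seeds. w \<in> {w. contested i j t w} \<longrightarrow> w \<in> {w. gets i t (w \<circ> swap i j t)}"
    by eventually_elim (use contested_swap[OF False] in blast)
  moreover have "{w. gets i t (w \<circ> swap i j t)} \<in> sets seeds"
    using measurable_compose[OF m gets_measurable[of i t]] by (simp add: pred_def)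
  ultimately have "measure seeds {w. contested i j t w} \<le> measure seeds {w. gets i t (w \<circ> swap i j t)}"
    by (rule seeds.finite_measure_mono_AE)
  also have "\<dots> = measure seeds {w. gets i t w}"
    by (rule prob_reindex[OF gets_measurable inj])
  finally show ?thesis .
qed

text \<open>The count by items matches the bound on contested items, the count by agents the bound
  on agents that are not stuck.\<close>

lemma Vcls_X: "Vcls N cls i (X w) = (\<Sum>t<n. of_bool (gets i t w))"
  and Vcls_X': "Vcls N cls i (X w) = (\<Sum>a\<in>class_of N cls i. of_bool (a \<in> taken (K w) S n))"
proof -
  have "(case dec (K w) S t of None \<Rightarrow> 0 | Some b \<Rightarrow> of_bool (b \<in> class_of N cls i)) =
      (of_bool (gets i t w) :: real)" for t
    by (cases "dec (K w) S t") auto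
  then show "Vcls N cls i (X w) = (\<Sum>t<n. of_bool (gets i t w))"
    unfolding Vcls_def card_X by simp
  have "class_of N cls i \<inter> N = class_of N cls i" by (auto simp: class_of_def)
  then show "Vcls N cls i (X w) = (\<Sum>a\<in>class_of N cls i. of_bool (a \<in> taken (K w) S n))"
    unfolding Vcls_def card_X_taken by simp
qed

text \<open>If an item held by \<open>j\<close> is liked by an agent of class \<open>i\<close>, then
  that agent is not stuck or the item is liked by a stuck agent of \<open>i\<close>; the two
  indicators form a cover.\<close>

lemma Vstar_X_le:
  "Vstar N cls M E i (ycls N cls j (X w)) \<le> (\<Sum>a\<in>class_of N cls i. of_bool (\<not> stuck w a)) +
     (\<Sum>t<n. of_bool (gets j t w \<and> (\<exists>a\<in>class_of N cls i. a \<in> S t \<and> stuck w a)))"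
proof -
  let ?c = "\<lambda>t. gets j t w \<and> (\<exists>a\<in>class_of N cls i. a \<in> S t \<and> stuck w a)"
  define \<beta> :: "'o \<Rightarrow> real" where "\<beta> x = of_bool (\<exists>t<n. os ! t = x \<and> ?c t)" for x
  have "Vstar N cls M E i (ycls N cls j (X w)) \<le>
      (\<Sum>a\<in>class_of N cls i. of_bool (\<not> stuck w a)) + (\<Sum>x\<in>M. \<beta> x)"
  proof (rule Vstar_le_cover[OF finM finN])
    fix x a assume xa: "(x, a) \<in> E" "x \<in> M" "a \<in> class_of N cls i" "ycls N cls j (X w) x = 1"
    from xa(4) obtain b where "b \<in> class_of N cls j" "(x, b) \<in> X w"
      by (auto simp: ycls_def split: if_splits)
    then obtain t where t: "t < n" "os ! t = x" "gets j t w"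
      by (auto simp: X_eq)
    moreover have "a \<in> S t"
      using xa t by (auto simp: S_def class_of_def)
    ultimately have "\<beta> x = 1" if "stuck w a"
      using that xa(3) unfolding \<beta>_def by auto
    then show "1 \<le> of_bool (\<not> stuck w a) + \<beta> x"
      by (cases "stuck w a") (auto simp: \<beta>_def)
  qed (auto simp: ycls_def \<beta>_def)
  also have "(\<Sum>x\<in>M. \<beta> x) = (\<Sum>t<n. \<beta> (os ! t))"
    using bij_betw_nth[OF dist_os refl set_os[symmetric]]
    by (intro sum.reindex_bij_betw[symmetric]) (simp add: set_os)
  also have "\<dots> = (\<Sum>t<n. of_bool (?c t))"
  proof (rule sum.cong[OF refl])
    fix t assume "t \<in> {..<n}"
    then have "(\<exists>s<n. os ! s = os ! t \<and> ?c s) \<longleftrightarrow> ?c t"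
      using dist_os by (auto simp: nth_eq_iff_index_eq)
    then show "\<beta> (os ! t) = of_bool (?c t)" unfolding \<beta>_def by simp
  qed
  finally show ?thesis .
qed

lemma integral_sum_of_bool:
  assumes [measurable]: "\<And>x. Measurable.pred seeds (P x)"
  shows "integrable seeds (\<lambda>w. \<Sum>x\<in>I. of_bool (P x w) :: real)"
    and "(\<integral>w. (\<Sum>x\<in>I. of_bool (P x w)) \<partial>seeds) = (\<Sum>x\<in>I. measure seeds {w. P x w})"
proof -
  have i: "integrable seeds (\<lambda>w. of_bool (P x w) :: real)" for x
    by (rule seeds.integrable_const_bound[where B = 1]) auto
  then show "integrable seeds (\<lambda>w. \<Sum>x\<in>I. of_bool (P x w) :: real)"
    by (rule Bochner_Integration.integrable_sum)
  show "(\<integral>w. (\<Sum>x\<in>I. of_bool (P x w)) \<partial>seeds) = (\<Sum>x\<in>I. measure seeds {w. P x w})"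
    unfolding Bochner_Integration.integral_sum[OF i] integral_of_bool_seeds[OF assms] ..
qed

text \<open>Each half of the cover, scaled by \<open>g\<close>, has expectation at most that of the
  value of class \<open>i\<close>; the two halves account for the denominator 2.\<close>

lemma cef_bound:
  "g / 2 * (\<integral>w. Vstar N cls M E i (ycls N cls j (X w)) \<partial>seeds) \<le> (\<integral>w. Vcls N cls i (X w) \<partial>seeds)"
proof -
  let ?A = "class_of N cls i"
  let ?c = "\<lambda>t w. gets j t w \<and> (\<exists>a\<in>?A. a \<in> S t \<and> stuck w a)"
  have c: "Measurable.pred seeds (?c t)" for t
    using finite_class by measurable
  have ns: "Measurable.pred seeds (\<lambda>w. \<not> stuck w a)" for a
    by measurable
  have "(\<integral>w. Vstar N cls M E i (ycls N cls j (X w)) \<partial>seeds) \<le>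
      (\<integral>w. (\<Sum>a\<in>?A. of_bool (\<not> stuck w a)) + (\<Sum>t<n. of_bool (?c t w)) \<partial>seeds)"
    using integral_sum_of_bool(1)[OF ns] integral_sum_of_bool(1)[OF c]
    by (intro integral_mono mixture.integrable_det_run Bochner_Integration.integrable_add Vstar_X_le)
  also have "\<dots> = (\<Sum>a\<in>?A. measure seeds {w. \<not> stuck w a}) + (\<Sum>t<n. measure seeds {w. ?c t w})"
    unfolding integral_sum_of_bool(2)[OF ns, symmetric] integral_sum_of_bool(2)[OF c, symmetric]
    by (intro Bochner_Integration.integral_add integral_sum_of_bool(1) ns c)
  finally have "g * (\<integral>w. Vstar N cls M E i (ycls N cls j (X w)) \<partial>seeds) \<le>
      g * ((\<Sum>a\<in>?A. measure seeds {w. \<not> stuck w a}) + (\<Sum>t<n. measure seeds {w. ?c t w}))"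
    using g0 by (rule mult_left_mono)
  also have "\<dots> = (\<Sum>a\<in>?A. g * measure seeds {w. \<not> stuck w a}) + (\<Sum>t<n. g * measure seeds {w. ?c t w})"
    by (simp add: distrib_left sum_distrib_left)
  also have "\<dots> \<le> (\<Sum>a\<in>?A. measure seeds {w. a \<in> taken (K w) S n}) + (\<Sum>t<n. measure seeds {w. gets i t w})"
    by (intro add_mono sum_mono prob_not_stuck)
       (rule order_trans[OF prob_stuck_le_contested prob_contested_le], simp)
  also have "(\<Sum>a\<in>?A. measure seeds {w. a \<in> taken (K w) S n}) = (\<integral>w. Vcls N cls i (X w) \<partial>seeds)"
    unfolding Vcls_X' by (rule integral_sum_of_bool(2)[OF taken_mem_measurable, symmetric])
  also have "(\<Sum>t<n. measure seeds {w. gets i t w}) = (\<integral>w. Vcls N cls i (X w) \<partial>seeds)"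
    unfolding Vcls_X by (rule integral_sum_of_bool(2)[OF gets_measurable, symmetric])
  finally show ?thesis by simp
qed

end

theorem theorem6:
  fixes \<gamma> :: real
  assumes "0 \<le> \<gamma>" and "\<gamma> \<le> 1"
  shows "\<exists>alg :: 'a online_alg. valid_alg alg \<and>
           is_USW (1 - exp (\<gamma> - 1) / (\<gamma> + 1)) alg TYPE('o) \<and>
           is_CEF (\<gamma> / 2) alg TYPE('o)"
proof (intro exI[of _ "threshold_alg \<gamma>"] conjI)
  have alg: "threshold_alg \<gamma> N cls = behavioural seeds (policy \<gamma> N cls)" if "finite N"
    for N :: "'a set" and cls
    using that by (simp add: threshold_alg_def fun_eq_iff)
  show "valid_alg (threshold_alg \<gamma> :: 'a online_alg)"
    unfolding valid_alg_def
  proof (intro allI)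
    fix N :: "'a set" and cls h S
    show "set_pmf (threshold_alg \<gamma> N cls h S) \<subseteq> insert None (Some ` {a \<in> S \<inter> N. a \<notin> matched_agents h})"
    proof (cases "finite N")
      case True
      interpret class_matching \<gamma> N cls
        using assms True by unfold_locales
      show ?thesis
        using mixture.set_pmf_behavioural unfolding alg[OF True] .
    next
      case False
      then show ?thesis by (simp add: threshold_alg_def)
    qed
  qed
  have inst: "class_matching_instance \<gamma> N M E os"
    if "instance_ok N M E" "arrival_order M os"
    for N :: "'a set" and M :: "'o set" and E os
    using that assms by unfold_locales (auto simp: instance_ok_def)
  show "is_USW (1 - exp (\<gamma> - 1) / (\<gamma> + 1)) (threshold_alg \<gamma> :: 'a online_alg) TYPE('o)"
    unfolding is_USW_def
  proof (intro allI impI)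
    fix N :: "'a set" and cls and M :: "'o set" and E os Xs
    assume a: "instance_ok N M E" "arrival_order M os" and Xs: "is_matching E Xs"
    interpret class_matching_instance \<gamma> N cls M E os
      using inst[OF a] .
    \<comment> \<open>The expectation over the history-based run becomes an integral over a single
      initial seed.\<close>
    note expectation = mixture.expectation_run_Nil[where alg = "threshold_alg \<gamma>" and cls = cls,
      OF alg[OF finN]]
    show "(1 - exp (\<gamma> - 1) / (\<gamma> + 1)) * usw Xs \<le>
        measure_pmf.expectation (run (threshold_alg \<gamma>) N cls E [] os) usw"
      unfolding expectation[of E os] by (rule usw_bound[OF Xs])
  qed
  show "is_CEF (\<gamma> / 2) (threshold_alg \<gamma> :: 'a online_alg) TYPE('o)"
    unfolding is_CEF_def
  proof (intro allI impI)
    fix N :: "'a set" and cls and M :: "'o set" and E os i j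
    assume a: "instance_ok N M E" "arrival_order M os"
    interpret class_matching_instance \<gamma> N cls M E os
      using inst[OF a] .
    note expectation = mixture.expectation_run_Nil[where alg = "threshold_alg \<gamma>" and cls = cls,
      OF alg[OF finN]]
    show "\<gamma> / 2 * measure_pmf.expectation (run (threshold_alg \<gamma>) N cls E [] os)
          (\<lambda>X. Vstar N cls M E i (ycls N cls j X)) \<le>
        measure_pmf.expectation (run (threshold_alg \<gamma>) N cls E [] os) (Vcls N cls i)"
      unfolding expectation[of E os] by (rule cef_bound)
  qed
qed

end
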